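(* Let $0<p<1<q<\infty$, and let $\mathbb{Y}$ be one of the spaces $\ell_p\oplus\ell_q$, $\ell_p(\ell_q)$, $\ell_q(\ell_p)$ or $\left(\bigoplus_{n=1}^\infty\ell_p^n\right)_{\ell_q}$. Then for every almost greedy basis $\mathcal{Y}$ of $\mathbb{Y}$ the fundamental function of $\mathcal{Y}$ satisfies $$\boldsymbol{\varphi_u^s}[\mathcal{Y},\mathbb{Y}](m)\approx m^{1/q},\qquad m\in\mathbb{N}.$$
   Context: $\ell_q(\ell_p)$ is the space of sequences $(f_n)_{n=1}^\infty$ in $\ell_p$ with quasi-norm $(\sum_n\|f_n\|_p^q)^{1/q}<\infty$ (and similarly $\ell_p(\ell_q)$); $(\bigoplus_n\ell_p^n)_{\ell_q}$ is the space of sequences $(f_n)$ with $f_n\in\ell_p^n$ ($n$-dimensional $\ell_p$) and $(\sum_n\|f_n\|_p^q)^{1/q}<\infty$. $a_m\approx b_m$ means equivalence up to multiplicative constants independent of $m$. A basis here is a Schauder basis $\mathcal{Y}=(\boldsymbol{y}_n)$ of a quasi-Banach space $\mathbb{Y}$ over $\mathbb{R}$ or $\mathbb{C}$, with coordinate functionals $(\boldsymbol{y}_n^* )$. For $A\subseteq\mathbb{N}$ finite, $S_A(f)=\sum_{n\in A}\boldsymbol{y}_n^*(f)\boldsymbol{y}_n$. A finite set $A$ is a greedy set of $f$ if $|\boldsymbol{y}_k^*(f)|\le|\boldsymbol{y}_j^*(f)|$ for all $j\in A$, $k\notin A$. $\mathcal{Y}$ is almost greedy if there is $C$ with $\|f-S_A(f)\|\le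 C\|f-S_B(f)\|$ for all $f$, all greedy sets $A$ of $f$ and all $B$ with $|B|\le|A|$ (equivalently, it is quasi-greedy and democratic). The fundamental function is $\boldsymbol{\varphi_u^s}[\mathcal{Y},\mathbb{Y}](m)=\sup\{\|\sum_{n\in A}\varepsilon_n\boldsymbol{y}_n\|\colon|A|\le m,\ |\varepsilon_n|=1\}$. *)

theory Defs
  imports "HOL-Analysis.Analysis" "HOL-Library.Function_Algebras"
begin

text \<open>
  Scalars range over a type of sort \<open>{real_normed_field, euclidean_space}\<close>. Both \<open>real\<close> and
  \<open>complex\<close> are instances, and they are the only ones up to isometric isomorphism: these are
  the finite-dimensional commutative real division algebras with a multiplicative norm.

  A quasi-normed space consists of a carrier inside an ambient additive group, a scalar
  multiplication and a quasi-norm; the addition is that of the ambient group (pointwise on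
  functions, componentwise on pairs).
\<close>

record ('k, 'v) qnspace =
  car :: "'v set"
  smult :: "'k \<Rightarrow> 'v \<Rightarrow> 'v"
  qnorm :: "'v \<Rightarrow> real"


subsection \<open>The spaces\<close>

definition lp :: "real \<Rightarrow> ('k::{real_normed_field,euclidean_space}, nat \<Rightarrow> 'k) qnspace" where
  "lp p = \<lparr> car = {x. summable (\<lambda>j. norm (x j) powr p)},
            smult = (\<lambda>c x j. c * x j),
            qnorm = (\<lambda>x. (\<Sum>j. norm (x j) powr p) powr (1 / p)) \<rparr>"

text \<open>The \<open>n\<close>-dimensional space: vectors are sequences vanishing outside \<open>{..<n}\<close>.\<close>

definition lp_dim ::
    "real \<Rightarrow> nat \<Rightarrow> ('k::{real_normed_field,euclidean_space}, nat \<Rightarrow> 'k) qnspace" where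
  "lp_dim p n = \<lparr> car = {x. \<forall>j\<ge>n. x j = 0},
                  smult = (\<lambda>c x j. c * x j),
                  qnorm = (\<lambda>x. (\<Sum>j<n. norm (x j) powr p) powr (1 / p)) \<rparr>"

definition direct_sum ::
    "('k, 'v) qnspace \<Rightarrow> ('k, 'w) qnspace \<Rightarrow> ('k, 'v \<times> 'w) qnspace" where
  "direct_sum E F = \<lparr> car = car E \<times> car F,
                      smult = (\<lambda>c z. (smult E c (fst z), smult F c (snd z))),
                      qnorm = (\<lambda>z. qnorm E (fst z) + qnorm F (snd z)) \<rparr>"

definition lr_sum :: "real \<Rightarrow> (nat \<Rightarrow> ('k, 'v) qnspace) \<Rightarrow> ('k, nat \<Rightarrow> 'v) qnspace" where
  "lr_sum r E = \<lparr> car = {f. (\<forall>n. f n \<in> car (E n)) \<and>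
                            summable (\<lambda>n. qnorm (E n) (f n) powr r)},
                  smult = (\<lambda>c f n. smult (E n) c (f n)),
                  qnorm = (\<lambda>f. (\<Sum>n. qnorm (E n) (f n) powr r) powr (1 / r)) \<rparr>"

definition lp_plus_lq :: "real \<Rightarrow> real \<Rightarrow>
    ('k::{real_normed_field,euclidean_space}, (nat \<Rightarrow> 'k) \<times> (nat \<Rightarrow> 'k)) qnspace" where
  "lp_plus_lq p q = direct_sum (lp p) (lp q)"

definition lr_of_ls :: "real \<Rightarrow> real \<Rightarrow>
    ('k::{real_normed_field,euclidean_space}, nat \<Rightarrow> nat \<Rightarrow> 'k) qnspace" where
  "lr_of_ls r s = lr_sum r (\<lambda>n. lp s)"

text \<open>Positions are counted from \<open>0\<close>, so the summand at position \<open>n\<close> has dimension \<open>n + 1\<close>.\<close>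

definition lq_sum_lp_dims :: "real \<Rightarrow> real \<Rightarrow>
    ('k::{real_normed_field,euclidean_space}, nat \<Rightarrow> nat \<Rightarrow> 'k) qnspace" where
  "lq_sum_lp_dims q p = lr_sum q (\<lambda>n. lp_dim p (Suc n))"


subsection \<open>Bases\<close>

definition expansion ::
    "('k, 'v::ab_group_add) qnspace \<Rightarrow> (nat \<Rightarrow> 'v) \<Rightarrow> (nat \<Rightarrow> 'k) \<Rightarrow> 'v \<Rightarrow> bool" where
  "expansion E y a f \<longleftrightarrow>
     (\<lambda>m. qnorm E (f - (\<Sum>n<m. smult E (a n) (y n)))) \<longlonglongrightarrow> 0"

definition schauder_basis ::
    "('k, 'v::ab_group_add) qnspace \<Rightarrow> (nat \<Rightarrow> 'v) \<Rightarrow> bool" where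
  "schauder_basis E y \<longleftrightarrow>
     (\<forall>n. y n \<in> car E) \<and> (\<forall>f\<in>car E. \<exists>!a. expansion E y a f)"

definition coord ::
    "('k, 'v::ab_group_add) qnspace \<Rightarrow> (nat \<Rightarrow> 'v) \<Rightarrow> nat \<Rightarrow> 'v \<Rightarrow> 'k" where
  "coord E y n f = (THE a. expansion E y a f) n"

definition basis_proj ::
    "('k, 'v::ab_group_add) qnspace \<Rightarrow> (nat \<Rightarrow> 'v) \<Rightarrow> nat set \<Rightarrow> 'v \<Rightarrow> 'v" where
  "basis_proj E y A f = (\<Sum>n\<in>A. smult E (coord E y n f) (y n))"

definition greedy_set ::
    "('k::real_normed_field, 'v::ab_group_add) qnspace \<Rightarrow> (nat \<Rightarrow> 'v) \<Rightarrow> 'v \<Rightarrow> nat set \<Rightarrow> bool"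
  where
  "greedy_set E y f A \<longleftrightarrow>
     finite A \<and> (\<forall>j\<in>A. \<forall>k. k \<notin> A \<longrightarrow> norm (coord E y k f) \<le> norm (coord E y j f))"

definition almost_greedy_basis ::
    "('k::real_normed_field, 'v::ab_group_add) qnspace \<Rightarrow> (nat \<Rightarrow> 'v) \<Rightarrow> bool" where
  "almost_greedy_basis E y \<longleftrightarrow>
     schauder_basis E y \<and>
     (\<exists>C. \<forall>f\<in>car E. \<forall>A B. greedy_set E y f A \<longrightarrow> finite B \<longrightarrow> card B \<le> card A \<longrightarrow>
        qnorm E (f - basis_proj E y A f) \<le> C * qnorm E (f - basis_proj E y B f))"

text \<open>The supremum is taken in \<open>ereal\<close>, so that finiteness is not presupposed.\<close>

definition fundamental_function ::
    "('k::real_normed_field, 'v::ab_group_add) qnspace \<Rightarrow> (nat \<Rightarrow> 'v) \<Rightarrow> nat \<Rightarrow> ereal" where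
  "fundamental_function E y m =
     Sup {ereal (qnorm E (\<Sum>n\<in>A. smult E (\<epsilon> n) (y n))) | A \<epsilon>.
            finite A \<and> card A \<le> m \<and> (\<forall>n\<in>A. norm (\<epsilon> n) = 1)}"

definition equivalent_up_to_const :: "(nat \<Rightarrow> ereal) \<Rightarrow> (nat \<Rightarrow> real) \<Rightarrow> bool" where
  "equivalent_up_to_const a b \<longleftrightarrow>
     (\<exists>c>0. \<exists>C>0. \<forall>m\<ge>1. ereal (c * b m) \<le> a m \<and> a m \<le> ereal (C * b m))"

end

theory Submission
  imports Defs "HOL-Complex_Analysis.Great_Picard"
begin

text \<open>
  The differences of a subsequence of the basis are, up to a summable error, disjointly supported
  blocks. In each of the four spaces such blocks have sums of \<open>m\<close> terms either of norm at least
  \<open>c m\<^sup>1\<^sup>/\<^sup>p\<close> or of norm comparable to \<open>m\<^sup>1\<^sup>/\<^sup>q\<close>, and by democracy the fundamental function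
  inherits this alternative. If it grows at least like \<open>m\<^sup>1\<^sup>/\<^sup>p\<close>, then every \<open>f\<close> has coefficients in
  weak \<open>\<ell>\<^sub>p\<close>, hence, as \<open>p < 1\<close>, in \<open>\<ell>\<^sub>1\<close> with a norm bound. The coefficient map would then send a
  copy of the unit vector basis of \<open>\<ell>\<^sub>q\<close> to a sequence in \<open>\<ell>\<^sub>1\<close> that is coordinatewise null and
  bounded below, so that sums of \<open>m\<close> of these unit vectors would have norm at least \<open>c m\<close> in place
  of \<open>m\<^sup>1\<^sup>/\<^sup>q\<close>, which is impossible for \<open>q > 1\<close>.
\<close>

subsection \<open>Bases of quasi-normed spaces\<close>

text \<open>For \<open>p < 1\<close> these spaces are not locally convex, so duality and weak
  compactness give little: a bounded sequence is only known to have a subsequence that converges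
  entry by entry, and the limit need not be 0. Differences of pairs remove the limit at no cost,
  since a sum of \<open>m\<close> differences is a combination of \<open>2 * m\<close> basis vectors
  with coefficients \<plusminus>1, which democracy compares with any other such sum.

  The alternative reflects two geometries: disjoint blocks may pile up on common rows, or spread
  over rows where they hardly meet. In \<open>\<ell>\<^sub>q(\<ell>\<^sub>p)\<close> piling up
  produces the exponent \<open>1 / p\<close> and spreading produces \<open>1 / q\<close>; in
  \<open>\<ell>\<^sub>p(\<ell>\<^sub>q)\<close> it is the other way round. The two remaining spaces
  embed isomorphically in these two and inherit the alternative.\<close>

locale quasi_normed =
  fixes E :: "('k::real_normed_field, 'v::ab_group_add) qnspace" and \<kappa> :: real
  assumes kappa: "1 \<le> \<kappa>"
    and zero_car: "0 \<in> car E"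
    and add_car: "f \<in> car E \<Longrightarrow> g \<in> car E \<Longrightarrow> f + g \<in> car E"
    and smult_car: "f \<in> car E \<Longrightarrow> smult E c f \<in> car E"
    and smult_add_right: "smult E c (f + g) = smult E c f + smult E c g"
    and smult_add_left: "smult E (c + d) f = smult E c f + smult E d f"
    and smult_assoc: "smult E c (smult E d f) = smult E (c * d) f"
    and smult_one: "smult E 1 f = f"
    and qnorm_nonneg: "0 \<le> qnorm E f"
    and qnorm_smult: "f \<in> car E \<Longrightarrow> qnorm E (smult E c f) = norm c * qnorm E f"
    and qnorm_zero_imp: "f \<in> car E \<Longrightarrow> qnorm E f = 0 \<Longrightarrow> f = 0"
    and qnorm_add: "f \<in> car E \<Longrightarrow> g \<in> car E \<Longrightarrow>
                      qnorm E (f + g) \<le> \<kappa> * (qnorm E f + qnorm E g)"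
begin

lemma smult_zero_left [simp]: "smult E 0 f = 0"
  using smult_add_left[of 0 0 f] by simp

lemma smult_zero_right [simp]: "smult E c 0 = 0"
  using smult_add_right[of c 0 0] by simp

lemma smult_minus_one: "smult E (- 1) f = - f"
  using smult_add_left[of "- 1" 1 f] by (simp add: smult_one eq_neg_iff_add_eq_0)

lemma qnorm_zero [simp]: "qnorm E 0 = 0"
  using qnorm_smult[OF zero_car, of 0] by simp

lemma uminus_car: "f \<in> car E \<Longrightarrow> - f \<in> car E"
  using smult_car[of f "- 1"] by (simp add: smult_minus_one)

lemma qnorm_uminus: "f \<in> car E \<Longrightarrow> qnorm E (- f) = qnorm E f"
  using qnorm_smult[of f "- 1"] by (simp add: smult_minus_one)

lemma diff_car: "f \<in> car E \<Longrightarrow> g \<in> car E \<Longrightarrow> f - g \<in> car E"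
  using add_car[OF _ uminus_car, of f g] by simp

lemma qnorm_diff:
  "f \<in> car E \<Longrightarrow> g \<in> car E \<Longrightarrow> qnorm E (f - g) \<le> \<kappa> * (qnorm E f + qnorm E g)"
  using qnorm_add[of f "- g"] by (simp add: uminus_car qnorm_uminus)

lemma sum_car: "(\<And>i. i \<in> A \<Longrightarrow> f i \<in> car E) \<Longrightarrow> (\<Sum>i\<in>A. f i) \<in> car E"
  by (induction A rule: infinite_finite_induct) (auto simp: zero_car add_car)

lemma smult_sum_right: "smult E c (\<Sum>i\<in>A. f i) = (\<Sum>i\<in>A. smult E c (f i))"
  by (induction A rule: infinite_finite_induct) (auto simp: smult_add_right)

text \<open>Peeling off one summand at a time multiplies everything that follows by
  \<open>\<kappa>\<close>, hence the growing powers. Errors that decay like the powers of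
  \<open>1 / (2 * \<kappa>)\<close> remain summable against them.\<close>

lemma qnorm_sum_le:
  assumes "\<And>j. e j \<in> car E"
  shows "qnorm E (\<Sum>j<m. e j) \<le> (\<Sum>j<m. \<kappa> ^ Suc j * qnorm E (e j))"
  using assms
proof (induction m arbitrary: e)
  case 0
  then show ?case by simp
next
  case (Suc m)
  have "qnorm E (\<Sum>j<Suc m. e j) = qnorm E (e 0 + (\<Sum>j<m. e (Suc j)))"
    by (simp only: sum.lessThan_Suc_shift)
  also have "\<dots> \<le> \<kappa> * (qnorm E (e 0) + qnorm E (\<Sum>j<m. e (Suc j)))"
    by (intro qnorm_add sum_car Suc.prems)
  also have "\<dots> \<le> \<kappa> * (qnorm E (e 0) + (\<Sum>j<m. \<kappa> ^ Suc j * qnorm E (e (Suc j))))"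
    using kappa Suc.IH[of "\<lambda>j. e (Suc j)"] Suc.prems by (intro mult_left_mono add_left_mono) auto
  also have "\<dots> = (\<Sum>j<Suc m. \<kappa> ^ Suc j * qnorm E (e j))"
    by (simp add: sum.lessThan_Suc_shift sum_distrib_left algebra_simps del: sum.lessThan_Suc)
  finally show ?case .
qed

lemma qnorm_triangle_lower:
  assumes "f \<in> car E" "g \<in> car E"
  shows "qnorm E f \<le> \<kappa> * (qnorm E g + qnorm E (f - g))"
  using qnorm_add[of g "f - g"] assms diff_car by simp

end

locale qn_basis = quasi_normed E \<kappa>
  for E :: "('k::real_normed_field, 'v::ab_group_add) qnspace" and \<kappa> :: real +
  fixes y :: "nat \<Rightarrow> 'v"
  assumes basis: "schauder_basis E y"
begin

lemma y_car: "y n \<in> car E"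
  using basis by (auto simp: schauder_basis_def)

lemma expansion_coord: "f \<in> car E \<Longrightarrow> expansion E y (\<lambda>n. coord E y n f) f"
proof -
  assume "f \<in> car E"
  then have "\<exists>!a. expansion E y a f"
    using basis by (auto simp: schauder_basis_def)
  from theI'[OF this] show ?thesis
    unfolding coord_def .
qed

lemma coord_eqI: "f \<in> car E \<Longrightarrow> expansion E y a f \<Longrightarrow> coord E y n f = a n"
  using basis expansion_coord[of f] unfolding schauder_basis_def by metis

definition comb :: "(nat \<Rightarrow> 'k) \<Rightarrow> nat set \<Rightarrow> 'v" where
  "comb c A = (\<Sum>n\<in>A. smult E (c n) (y n))"

lemma comb_car: "comb c A \<in> car E"
  unfolding comb_def by (intro sum_car smult_car y_car)

lemma comb_cong: "(\<And>n. n \<in> A \<Longrightarrow> c n = d n) \<Longrightarrow> comb c A = comb d A"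
  unfolding comb_def by (intro sum.cong) auto

lemma comb_union: "finite A \<Longrightarrow> finite B \<Longrightarrow> A \<inter> B = {} \<Longrightarrow> comb c (A \<union> B) = comb c A + comb c B"
  unfolding comb_def by (rule sum.union_disjoint)

lemma comb_add: "comb (\<lambda>n. c n + d n) A = comb c A + comb d A"
  unfolding comb_def by (simp add: smult_add_left sum.distrib)

lemma comb_smult: "comb (\<lambda>n. t * c n) A = smult E t (comb c A)"
  unfolding comb_def by (simp add: smult_sum_right smult_assoc)

lemma comb_restrict: "finite A \<Longrightarrow> comb (\<lambda>n. if n \<in> B then c n else 0) A = comb c (A \<inter> B)"
  unfolding comb_def by (subst sum.inter_restrict) (auto intro!: sum.cong)

lemma expansion_iff: "expansion E y a f \<longleftrightarrow> (\<lambda>m. qnorm E (f - comb a {..<m})) \<longlonglongrightarrow> 0"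
  unfolding expansion_def comb_def by simp

lemma coord_add:
  assumes "f \<in> car E" "g \<in> car E"
  shows "coord E y n (f + g) = coord E y n f + coord E y n g"
proof (rule coord_eqI)
  let ?a = "\<lambda>n. coord E y n f" and ?b = "\<lambda>n. coord E y n g"
  show "f + g \<in> car E" using assms by (rule add_car)
  have "(\<lambda>m. \<kappa> * (qnorm E (f - comb ?a {..<m}) + qnorm E (g - comb ?b {..<m}))) \<longlonglongrightarrow> \<kappa> * (0 + 0)"
    using expansion_coord assms unfolding expansion_iff by (intro tendsto_intros) auto
  then have lim: "(\<lambda>m. \<kappa> * (qnorm E (f - comb ?a {..<m}) + qnorm E (g - comb ?b {..<m}))) \<longlonglongrightarrow> 0"
    by simp
  have "qnorm E (f + g - comb (\<lambda>n. ?a n + ?b n) {..<m}) \<le>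
        \<kappa> * (qnorm E (f - comb ?a {..<m}) + qnorm E (g - comb ?b {..<m}))" for m
    using qnorm_add[of "f - comb ?a {..<m}" "g - comb ?b {..<m}"] assms comb_car
    by (simp add: comb_add diff_car algebra_simps)
  then show "expansion E y (\<lambda>n. ?a n + ?b n) (f + g)"
    unfolding expansion_iff
    by (intro tendsto_sandwich[OF _ _ tendsto_const lim]) (auto simp: qnorm_nonneg)
qed

lemma coord_smult:
  assumes "f \<in> car E"
  shows "coord E y n (smult E t f) = t * coord E y n f"
proof (rule coord_eqI)
  let ?a = "\<lambda>n. coord E y n f"
  show "smult E t f \<in> car E" using assms by (rule smult_car)
  have "smult E t f - comb (\<lambda>n. t * ?a n) {..<m} = smult E t (f - comb ?a {..<m})" for m
    unfolding comb_smult
    using smult_add_right[of t "f - comb ?a {..<m}" "comb ?a {..<m}"] by simp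
  then have "qnorm E (smult E t f - comb (\<lambda>n. t * ?a n) {..<m}) =
      norm t * qnorm E (f - comb ?a {..<m})" for m
    by (simp add: qnorm_smult diff_car assms comb_car)
  moreover have "(\<lambda>m. norm t * qnorm E (f - comb ?a {..<m})) \<longlonglongrightarrow> norm t * 0"
    using expansion_coord assms unfolding expansion_iff by (intro tendsto_intros) auto
  ultimately show "expansion E y (\<lambda>n. t * ?a n) (smult E t f)"
    unfolding expansion_iff by simp
qed

lemma expansion_comb:
  assumes "finite A"
  shows "expansion E y (\<lambda>n. if n \<in> A then c n else 0) (comb c A)"
  unfolding expansion_iff
proof (rule tendsto_eventually)
  obtain N where "A \<subseteq> {..<N}" using assms finite_nat_set_iff_bounded by auto
  then have "comb (\<lambda>n. if n \<in> A then c n else 0) {..<m} = comb c A" if "m \<ge> N" for m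
    using that by (subst comb_restrict) (auto intro!: arg_cong[where f = "comb c"])
  then show "\<forall>\<^sub>F m in sequentially.
      qnorm E (comb c A - comb (\<lambda>n. if n \<in> A then c n else 0) {..<m}) = 0"
    by (auto intro!: eventually_sequentiallyI[of N])
qed

lemma coord_comb: "finite A \<Longrightarrow> coord E y n (comb c A) = (if n \<in> A then c n else 0)"
  using coord_eqI[OF comb_car expansion_comb] .

lemma coord_zero: "coord E y n 0 = 0"
  using coord_comb[of "{}" n undefined] by (simp add: comb_def)

lemma coord_sum:
  "(\<And>i. i \<in> A \<Longrightarrow> f i \<in> car E) \<Longrightarrow> coord E y n (\<Sum>i\<in>A. f i) = (\<Sum>i\<in>A. coord E y n (f i))"
  by (induction A rule: infinite_finite_induct) (auto simp: coord_zero coord_add sum_car)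

lemma y_nonzero: "y n \<noteq> 0"
proof
  assume "y n = 0"
  then have "comb (\<lambda>_. 1) {n} = 0"
    by (simp add: comb_def)
  then show False
    using coord_comb[of "{n}" n "\<lambda>_. 1"] coord_zero by simp
qed

lemma qnorm_y_pos: "0 < qnorm E (y n)"
  using qnorm_nonneg[of "y n"] qnorm_zero_imp[OF y_car, of n] y_nonzero[of n] by fastforce

lemma basis_proj_comb: "basis_proj E y A f = comb (\<lambda>n. coord E y n f) A"
  unfolding basis_proj_def comb_def ..

lemma basis_proj_of_comb:
  assumes "finite A" "finite B"
  shows "basis_proj E y B (comb c A) = comb c (B \<inter> A)"
  unfolding basis_proj_comb using assms by (simp add: coord_comb comb_restrict)

text \<open>Each term of the expansion is the difference of two consecutive remainders, and these
  tend to 0 in quasi-norm.\<close>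

lemma coord_term_tendsto:
  assumes f: "f \<in> car E"
  shows "(\<lambda>n. norm (coord E y n f) * qnorm E (y n)) \<longlonglongrightarrow> 0"
proof -
  let ?a = "\<lambda>n. coord E y n f"
  let ?r = "\<lambda>m. qnorm E (f - comb ?a {..<m})"
  have lim: "?r \<longlonglongrightarrow> 0"
    using expansion_coord[OF f] unfolding expansion_iff .
  have "(\<lambda>m. \<kappa> * (?r m + ?r (Suc m))) \<longlonglongrightarrow> \<kappa> * (0 + 0)"
    by (intro tendsto_intros lim LIMSEQ_Suc[OF lim])
  then have lim': "(\<lambda>m. \<kappa> * (?r m + ?r (Suc m))) \<longlonglongrightarrow> 0" by simp
  have "norm (?a n) * qnorm E (y n) \<le> \<kappa> * (?r n + ?r (Suc n))" for n
  proof -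
    have "smult E (?a n) (y n) = (f - comb ?a {..<n}) - (f - comb ?a {..<Suc n})"
      by (simp add: comb_def)
    then have "norm (?a n) * qnorm E (y n) =
        qnorm E ((f - comb ?a {..<n}) - (f - comb ?a {..<Suc n}))"
      using qnorm_smult[OF y_car, of "?a n" n] by simp
    also have "\<dots> \<le> \<kappa> * (?r n + ?r (Suc n))"
      by (intro qnorm_diff diff_car f comb_car)
    finally show ?thesis .
  qed
  then show ?thesis
    by (intro tendsto_sandwich[OF _ _ tendsto_const lim']) (auto simp: qnorm_nonneg)
qed

end

section \<open>Democracy and lower estimates for almost greedy bases\<close>

lemma obtain_disjoint_nat_set:
  assumes "finite (A :: nat set)"
  obtains D where "finite D" "card D = m" "A \<inter> D = {}"
proof -
  obtain N where "\<forall>n\<in>A. n < N" using assms finite_nat_set_iff_bounded by auto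
  then have "A \<inter> {N..<N + m} = {}" by auto
  then show ?thesis using that[of "{N..<N + m}"] by simp
qed

locale almost_greedy = qn_basis E \<kappa> y
  for E :: "('k::real_normed_field, 'v::ab_group_add) qnspace" and \<kappa> :: real and y +
  fixes C :: real
  assumes C: "1 \<le> C"
    and greedy: "f \<in> car E \<Longrightarrow> greedy_set E y f A \<Longrightarrow> finite B \<Longrightarrow> card B \<le> card A \<Longrightarrow>
        qnorm E (f - basis_proj E y A f) \<le> C * qnorm E (f - basis_proj E y B f)"
begin

lemma greedy_exchange:
  assumes fin: "finite A" "finite B" and disj: "A \<inter> B = {}" and le: "card B \<le> card A"
    and c: "\<And>i j. i \<in> A \<Longrightarrow> j \<in> B \<Longrightarrow> norm (c j) \<le> norm (c i)"
  shows "qnorm E (comb c B) \<le> C * qnorm E (comb c A)"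
proof -
  \<comment> \<open>removing the greedy set \<open>A\<close> of \<open>?f\<close> leaves the part on \<open>B\<close>, removing \<open>B\<close> leaves the part on \<open>A\<close>\<close>
  let ?f = "comb c (A \<union> B)"
  have "greedy_set E y ?f A"
    unfolding greedy_set_def using fin c by (auto simp: coord_comb)
  then have "qnorm E (?f - basis_proj E y A ?f) \<le> C * qnorm E (?f - basis_proj E y B ?f)"
    using fin le by (intro greedy comb_car)
  then show ?thesis
    using fin disj
    by (simp add: basis_proj_of_comb Int_absorb2) (simp add: comb_union)
qed

text \<open>The sets may overlap, so each is compared with a third set \<open>D\<close> disjoint
  from both; two exchanges give \<open>C\<^sup>2\<close>. An exchange sees only moduli, which is why
  the signs on both sides are arbitrary.\<close>

lemma democratic:
  assumes fin: "finite A" "finite B" and le: "card A \<le> card B"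
    and \<epsilon>: "\<And>n. n \<in> A \<Longrightarrow> norm (\<epsilon> n) = 1" and \<delta>: "\<And>n. n \<in> B \<Longrightarrow> norm (\<delta> n) = 1"
  shows "qnorm E (comb \<epsilon> A) \<le> C\<^sup>2 * qnorm E (comb \<delta> B)"
proof -
  obtain D where D: "finite D" "card D = card B" "(A \<union> B) \<inter> D = {}"
    using obtain_disjoint_nat_set fin by (metis finite_UnI)
  have *: "qnorm E (comb c X) \<le> C * qnorm E (comb d Y)"
    if "finite X" "finite Y" "X \<inter> Y = {}" "card X \<le> card Y"
      "\<And>n. n \<in> X \<Longrightarrow> norm (c n) = 1" "\<And>n. n \<in> Y \<Longrightarrow> norm (d n) = 1" for c d X Y
  proof -
    let ?e = "\<lambda>n. if n \<in> X then c n else d n"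
    have "qnorm E (comb ?e X) \<le> C * qnorm E (comb ?e Y)"
      using that by (intro greedy_exchange) auto
    moreover have "comb ?e X = comb c X" "comb ?e Y = comb d Y"
      using that(3) by (auto intro!: comb_cong)
    ultimately show ?thesis by simp
  qed
  have "qnorm E (comb \<epsilon> A) \<le> C * qnorm E (comb (\<lambda>_. 1) D)"
    using fin le \<epsilon> D by (intro *) auto
  also have "\<dots> \<le> C * (C * qnorm E (comb \<delta> B))"
    using fin le \<delta> D C by (intro * mult_left_mono) auto
  finally show ?thesis by (simp add: power2_eq_square)
qed

lemma qnorm_y_le: "qnorm E (y i) \<le> C\<^sup>2 * qnorm E (y j)"
  using democratic[of "{i}" "{j}" "\<lambda>_. 1" "\<lambda>_. 1"] by (simp add: comb_def smult_one)

text \<open>The terms of the expansion tend to 0 and, by democracy for singletons, the basis vectors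
  are bounded away from 0. Level sets of the coefficients are therefore finite and thus
  greedy.\<close>

lemma coord_tendsto_0:
  assumes "f \<in> car E"
  shows "(\<lambda>n. coord E y n f) \<longlonglongrightarrow> 0"
proof -
  let ?K = "C\<^sup>2 / qnorm E (y 0)"
  have K: "1 \<le> ?K * qnorm E (y n)" for n
    using qnorm_y_le[of 0 n] qnorm_y_pos[of 0] by (simp add: field_simps)
  have "(\<lambda>n. ?K * (norm (coord E y n f) * qnorm E (y n))) \<longlonglongrightarrow> ?K * 0"
    by (intro tendsto_intros coord_term_tendsto assms)
  then have lim: "(\<lambda>n. ?K * (norm (coord E y n f) * qnorm E (y n))) \<longlonglongrightarrow> 0" by simp
  have "norm (coord E y n f) \<le> ?K * (norm (coord E y n f) * qnorm E (y n))" for n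
    using mult_left_mono[OF K[of n] norm_ge_zero[of "coord E y n f"]] by (simp add: mult_ac)
  then show ?thesis
    by (intro Lim_null_comparison[OF _ lim]) auto
qed

lemma level_set:
  assumes f: "f \<in> car E" and t: "0 < t"
  shows "greedy_set E y f {n. t \<le> norm (coord E y n f)}"
proof -
  have "\<forall>\<^sub>F n in sequentially. norm (coord E y n f) < t"
    using tendsto_norm_zero[OF coord_tendsto_0[OF f]] t by (rule order_tendstoD(2))
  then have "finite {n. t \<le> norm (coord E y n f)}"
    unfolding eventually_cofinite cofinite_eq_sequentially[symmetric] by (simp add: not_less)
  then show ?thesis unfolding greedy_set_def by auto
qed

text \<open>The factor \<open>C ^ 3\<close> collects one exchange and one use of democracy;
  \<open>\<kappa> * (1 + C)\<close> bounds the projections onto greedy sets.\<close>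

definition lower_const :: real where "lower_const = C ^ 3 * (\<kappa> * (1 + C))"

lemma lower_const_pos: "0 < lower_const"
  unfolding lower_const_def using C kappa by simp

text \<open>This weak-type inequality turns growth of the fundamental function into decay of the
  coefficients. Besides an exchange it rests on the boundedness of the projections onto greedy sets,
  which is the greedy inequality with an empty competitor.\<close>

lemma large_coordinates:
  assumes f: "f \<in> car E" and t: "0 < t" and D: "finite D" "card D \<le> card A"
    and A: "A = {n. t \<le> norm (coord E y n f)}"
    and \<epsilon>: "\<And>n. n \<in> D \<Longrightarrow> norm (\<epsilon> n) = 1"
  shows "t * qnorm E (comb \<epsilon> D) \<le> lower_const * qnorm E f"
proof -
  have gr: "greedy_set E y f A" unfolding A using level_set f t .
  then have fin: "finite A" unfolding greedy_set_def by blast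
  obtain B where B: "finite B" "card B = card A" "A \<inter> B = {}"
    using obtain_disjoint_nat_set fin by metis
  \<comment> \<open>exchanging \<open>A\<close> and \<open>B\<close> in \<open>S\<^sub>A f + t \<Sum>\<^bsub>n\<in>B\<^esub> y\<^sub>n\<close> replaces the usual summation by parts, which needs convexity\<close>
  let ?c = "\<lambda>n. if n \<in> A then coord E y n f else of_real t * 1"
  have "qnorm E (comb ?c B) \<le> C * qnorm E (comb ?c A)"
    using fin B t A by (intro greedy_exchange) auto
  moreover have "comb ?c B = comb (\<lambda>n. of_real t * 1) B" "comb ?c A = basis_proj E y A f"
    unfolding basis_proj_comb using B(3) by (auto intro!: comb_cong)
  ultimately have 1: "t * qnorm E (comb (\<lambda>_. 1) B) \<le> C * qnorm E (basis_proj E y A f)"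
    using t by (simp only: comb_smult) (simp add: qnorm_smult comb_car)
  have "qnorm E (f - basis_proj E y A f) \<le> C * qnorm E (f - basis_proj E y {} f)"
    using f gr by (intro greedy) auto
  then have "qnorm E (f - basis_proj E y A f) \<le> C * qnorm E f"
    by (simp add: basis_proj_def)
  moreover have "qnorm E (basis_proj E y A f) \<le> \<kappa> * (qnorm E f + qnorm E (f - basis_proj E y A f))"
    using qnorm_diff[of f "f - basis_proj E y A f"] f comb_car
    by (simp add: diff_car basis_proj_comb)
  ultimately have "qnorm E (basis_proj E y A f) \<le> \<kappa> * (qnorm E f + C * qnorm E f)"
    using kappa by (meson add_left_mono mult_left_mono order_trans zero_le_one)
  then have 2: "C * qnorm E (basis_proj E y A f) \<le> C * (\<kappa> * (qnorm E f + C * qnorm E f))"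
    using C by (intro mult_left_mono) auto
  have "qnorm E (comb \<epsilon> D) \<le> C\<^sup>2 * qnorm E (comb (\<lambda>_. 1) B)"
    using D B \<epsilon> by (intro democratic) auto
  then have "t * qnorm E (comb \<epsilon> D) \<le> t * (C\<^sup>2 * qnorm E (comb (\<lambda>_. 1) B))"
    using t by (intro mult_left_mono) auto
  also have "\<dots> = C\<^sup>2 * (t * qnorm E (comb (\<lambda>_. 1) B))" by simp
  also have "\<dots> \<le> C\<^sup>2 * (C * (\<kappa> * (qnorm E f + C * qnorm E f)))"
    using 1 2 by (intro mult_left_mono) auto
  also have "\<dots> = lower_const * qnorm E f"
    by (simp add: lower_const_def power2_eq_square power3_eq_cube algebra_simps)
  finally show ?thesis .
qed

text \<open>Uniform boundedness of the coordinate functionals is \<open>large_coordinates\<close>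
  with the modulus of the n-th coefficient as threshold, whose level set contains \<open>n\<close>,
  and with \<open>D = {0}\<close>.\<close>

lemma coord_bound:
  assumes f: "f \<in> car E"
  shows "norm (coord E y n f) \<le> lower_const / qnorm E (y 0) * qnorm E f"
proof (cases "coord E y n f = 0")
  case True
  then show ?thesis using lower_const_pos qnorm_nonneg by simp
next
  case False
  let ?A = "{k. norm (coord E y n f) \<le> norm (coord E y k f)}"
  have "finite ?A" using level_set[OF f, of "norm (coord E y n f)"] False
    unfolding greedy_set_def by simp
  then have "card {0::nat} \<le> card ?A"
    by (metis (mono_tags, lifting) One_nat_def Suc_leI card.empty card.insert card_gt_0_iff
        empty_iff finite.emptyI mem_Collect_eq order_refl)
  then have "norm (coord E y n f) * qnorm E (comb (\<lambda>_. 1) {0}) \<le> lower_const * qnorm E f"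
    using False f by (intro large_coordinates[of _ _ _ ?A]) auto
  then show ?thesis
    using qnorm_y_pos[of 0] by (simp add: comb_def smult_one field_simps)
qed

end

subsection \<open>The coefficients are not in \<open>\<ell>\<^sub>1\<close>\<close>

text \<open>In decreasing order, the level set at the j-th value has at least \<open>j\<close>
  elements, so that value is at most \<open>K * j powr (- r)\<close>. The induction removes a
  minimal element, whose level set is all of \<open>F\<close>.\<close>

lemma sum_le_of_card_level_sets:
  fixes v :: "'a \<Rightarrow> real"
  assumes "finite F" "\<And>i. i \<in> F \<Longrightarrow> 0 \<le> v i" "0 \<le> K" "0 \<le> r"
    and "\<And>t. 0 < t \<Longrightarrow> t * real (card {i\<in>F. t \<le> v i}) powr r \<le> K"
  shows "sum v F \<le> K * (\<Sum>j=1..card F. real j powr (- r))"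
  using assms
proof (induction "card F" arbitrary: F)
  case 0
  then show ?case by simp
next
  case (Suc m)
  then have "F \<noteq> {}" by auto
  then obtain i where i: "i \<in> F" "\<And>j. j \<in> F \<Longrightarrow> v i \<le> v j"
    using arg_min_if_finite[OF \<open>finite F\<close>, of v] by (meson not_less)
  have "card (F - {i}) = m" using Suc.hyps i Suc.prems(1) by simp
  have "sum v (F - {i}) \<le> K * (\<Sum>j=1..card (F - {i}). real j powr (- r))"
  proof (rule Suc.hyps(1))
    fix t :: real assume t: "0 < t"
    have "card {j \<in> F - {i}. t \<le> v j} \<le> card {j \<in> F. t \<le> v j}"
      using Suc.prems(1) by (intro card_mono) auto
    then have "t * real (card {j \<in> F - {i}. t \<le> v j}) powr r \<le>
        t * real (card {j \<in> F. t \<le> v j}) powr r"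
      using t Suc.prems(4) by (intro mult_left_mono powr_mono2) auto
    then show "t * real (card {j \<in> F - {i}. t \<le> v j}) powr r \<le> K"
      using Suc.prems(5)[OF t] by linarith
  qed (use Suc \<open>card (F - {i}) = m\<close> in auto)
  moreover have "v i \<le> K * real (Suc m) powr (- r)"
  proof (cases "v i = 0")
    case False
    then have "0 < v i" using Suc.prems(2)[OF i(1)] by simp
    moreover have "{j \<in> F. v i \<le> v j} = F" using i(2) by auto
    ultimately have "v i * real (Suc m) powr r \<le> K"
      using Suc.prems(5)[of "v i"] Suc.hyps(2) by simp
    then show ?thesis by (simp add: powr_minus field_simps)
  qed (use Suc.prems in auto)
  ultimately have "sum v (F - {i}) + v i \<le>
      K * (\<Sum>j=1..m. real j powr (- r)) + K * real (Suc m) powr (- r)"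
    using \<open>card (F - {i}) = m\<close> by simp
  then show ?case
    using i(1) Suc.prems(1) by (simp add: Suc.hyps(2)[symmetric] sum.remove algebra_simps)
qed

text \<open>Division by \<open>m powr (1 / q)\<close> would bound \<open>m powr (1 - 1 / q)\<close>,
  which is unbounded for \<open>q > 1\<close>. Both contradictions with the upper
  \<open>\<ell>\<^sub>q\<close> estimate end here.\<close>

lemma linear_not_le_powr:
  fixes q \<delta> K :: real
  assumes q: "1 < q" and \<delta>: "0 < \<delta>" and le: "\<And>m::nat. real m * \<delta> \<le> K * real m powr (1 / q)"
  shows False
proof -
  define s where "s = 1 - 1 / q"
  have s: "0 < s" using q by (simp add: s_def)
  define x where "x = max 1 (K / \<delta> + 1)"
  obtain m where "x powr (1 / s) \<le> real m" using real_arch_simple by blast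
  moreover have "1 \<le> x powr (1 / s)" using s by (intro ge_one_powr_ge_zero) (auto simp: x_def)
  moreover have "(x powr (1 / s)) powr s = x" using s by (simp add: powr_powr x_def)
  ultimately have m: "K / \<delta> + 1 \<le> real m powr (1 - 1 / q)" "1 \<le> m"
    using powr_mono2[of s "x powr (1 / s)" "real m"] s by (auto simp: s_def x_def)
  have "K * real m powr (1 / q) < \<delta> * real m powr (1 - 1 / q) * real m powr (1 / q)"
    using m \<delta> by (intro mult_strict_right_mono) (auto simp: field_simps)
  also have "\<dots> = real m * \<delta>"
    using m by (simp add: mult.assoc flip: powr_add)
  finally show False using le[of m] by simp
qed

text \<open>The sequence \<open>u\<close> is dominated by the unit vectors of \<open>\<ell>\<^sub>q\<close> on vectors with coefficients of modulus
  \<open>1\<close>, and \<open>U\<close> consists of bounded functionals which keep \<open>u\<close> away from \<open>0\<close> in the Banach envelope.\<close>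

definition lq_units :: "('k::real_normed_field, 'v::ab_group_add) qnspace \<Rightarrow> real \<Rightarrow>
    (nat \<Rightarrow> 'v) \<Rightarrow> (nat \<Rightarrow> 'v \<Rightarrow> 'k) \<Rightarrow> bool" where
  "lq_units E q u U \<longleftrightarrow>
     (\<forall>k. u k \<in> car E) \<and>
     (\<forall>F s. finite F \<longrightarrow> (\<forall>k\<in>F. norm (s k) = 1) \<longrightarrow>
        qnorm E (\<Sum>k\<in>F. smult E (s k) (u k)) \<le> real (card F) powr (1 / q)) \<and>
     (\<forall>k f g. U k (f + g) = U k f + U k g) \<and>
     (\<forall>k c f. U k (smult E c f) = c * U k f) \<and>
     (\<forall>k. \<forall>f\<in>car E. norm (U k f) \<le> qnorm E f) \<and>
     (\<forall>k. U k (u k) = 1)"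

lemma lq_unitsD:
  assumes "lq_units E q u U"
  shows "u k \<in> car E"
    and "finite F \<Longrightarrow> (\<And>k. k \<in> F \<Longrightarrow> norm (s k) = 1) \<Longrightarrow>
      qnorm E (\<Sum>k\<in>F. smult E (s k) (u k)) \<le> real (card F) powr (1 / q)"
    and "U k (f + g) = U k f + U k g"
    and "U k (smult E c f) = c * U k f"
    and "f \<in> car E \<Longrightarrow> norm (U k f) \<le> qnorm E f"
    and "U k (u k) = 1"
  using assms unfolding lq_units_def by simp_all

context almost_greedy
begin

text \<open>By \<open>large_coordinates\<close> the growth \<open>m powr (1 / p)\<close> puts the
  coefficients in weak \<open>\<ell>\<^sub>p\<close>: the j-th largest is at most a constant times
  \<open>j powr (- (1 / p))\<close>. The series of these bounds converges because
  \<open>p < 1\<close>.\<close>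

lemma sum_coord_bound:
  assumes p: "0 < p" "p < 1" and c: "0 < c"
    and low: "\<And>m. \<exists>A \<epsilon>. finite A \<and> card A = m \<and> (\<forall>n\<in>A. norm (\<epsilon> n) = 1) \<and>
        c * real m powr (1 / p) \<le> qnorm E (comb \<epsilon> A)"
  obtains K where "0 \<le> K"
    "\<And>f N. f \<in> car E \<Longrightarrow> (\<Sum>n<N. norm (coord E y n f)) \<le> K * qnorm E f"
proof -
  let ?S = "\<lambda>j::nat. real j powr (- (1 / p))"
  have summ: "summable ?S" using p by (simp add: summable_real_powr_iff)
  have "(\<Sum>n<N. norm (coord E y n f)) \<le> (lower_const / c * suminf ?S) * qnorm E f"
    if f: "f \<in> car E" for f N
  proof -
    have "(\<Sum>n<N. norm (coord E y n f)) \<le>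
        (lower_const / c * qnorm E f) * (\<Sum>j=1..card {..<N}. ?S j)"
    proof (rule sum_le_of_card_level_sets)
      fix t :: real assume t: "0 < t"
      let ?m = "card {n \<in> {..<N}. t \<le> norm (coord E y n f)}"
      let ?A = "{n. t \<le> norm (coord E y n f)}"
      have "?m \<le> card ?A"
        using level_set[OF f t] unfolding greedy_set_def by (intro card_mono) auto
      moreover obtain D \<epsilon> where D: "finite D" "card D = ?m" "\<forall>n\<in>D. norm (\<epsilon> n) = 1"
        "c * real ?m powr (1 / p) \<le> qnorm E (comb \<epsilon> D)" using low by blast
      ultimately have "t * qnorm E (comb \<epsilon> D) \<le> lower_const * qnorm E f"
        using f t by (intro large_coordinates[where A = ?A]) auto
      then have "t * (c * real ?m powr (1 / p)) \<le> lower_const * qnorm E f"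
        using D(4) t by (meson mult_left_mono order_trans less_imp_le)
      then show "t * real ?m powr (1 / p) \<le> lower_const / c * qnorm E f"
        using c by (simp add: field_simps)
    qed (use p c lower_const_pos qnorm_nonneg in auto)
    also have "\<dots> \<le> (lower_const / c * qnorm E f) * suminf ?S"
      using summ c lower_const_pos qnorm_nonneg
      by (intro mult_left_mono sum_le_suminf mult_nonneg_nonneg divide_nonneg_pos) auto
    finally show ?thesis by (simp add: mult_ac)
  qed
  moreover have "0 \<le> lower_const / c * suminf ?S"
    using summ c lower_const_pos by (intro mult_nonneg_nonneg suminf_nonneg) auto
  ultimately show thesis using that by blast
qed

text \<open>If infinitely many n-th coefficients had modulus at least \<delta>, phases of modulus 1
  could align \<open>m\<close> of them. The bounded n-th coordinate functional would then be at
  least \<open>m * \<delta>\<close> on a vector of quasi-norm at most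
  \<open>m powr (1 / q)\<close>.\<close>

lemma lq_units_coord_tendsto_0:
  assumes q: "1 < q" and units: "lq_units E q u U"
  shows "(\<lambda>k. coord E y n (u k)) \<longlonglongrightarrow> 0"
proof (rule ccontr)
  assume "\<not> ?thesis"
  then obtain \<delta> where \<delta>: "0 < \<delta>" "\<not> (\<forall>\<^sub>F k in sequentially. norm (coord E y n (u k)) < \<delta>)"
    unfolding tendsto_iff by auto
  then have inf: "infinite {k. \<delta> \<le> norm (coord E y n (u k))}"
    unfolding eventually_cofinite cofinite_eq_sequentially[symmetric] by (simp add: not_less)
  have "real m * \<delta> \<le> (lower_const / qnorm E (y 0)) * real m powr (1 / q)" for m
  proof -
    obtain F where F: "finite F" "card F = m" "F \<subseteq> {k. \<delta> \<le> norm (coord E y n (u k))}"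
      using infinite_arbitrarily_large[OF inf] by blast
    let ?a = "\<lambda>k. coord E y n (u k)"
    let ?s = "\<lambda>k. of_real (norm (?a k)) / ?a k"
    let ?f = "\<Sum>k\<in>F. smult E (?s k) (u k)"
    have u: "u k \<in> car E" for k by (rule lq_unitsD(1)[OF units])
    have nz: "?a k \<noteq> 0" if "k \<in> F" for k using that F(3) \<delta>(1) by auto
    then have "\<forall>k\<in>F. norm (?s k) = 1" by (simp add: norm_divide)
    then have le: "qnorm E ?f \<le> real (card F) powr (1 / q)"
      using F(1) by (intro lq_unitsD(2)[OF units]) auto
    have "coord E y n ?f = (\<Sum>k\<in>F. ?s k * ?a k)"
      using u by (simp add: coord_sum coord_smult smult_car)
    also have "\<dots> = of_real (\<Sum>k\<in>F. norm (?a k))"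
      using nz by simp
    finally have "norm (coord E y n ?f) = (\<Sum>k\<in>F. norm (?a k))"
      by (simp only: norm_of_real abs_of_nonneg sum_nonneg norm_ge_zero)
    moreover have "real m * \<delta> \<le> (\<Sum>k\<in>F. norm (?a k))"
      using sum_bounded_below[of F \<delta> "\<lambda>k. norm (?a k)"] F by auto
    moreover have "norm (coord E y n ?f) \<le> lower_const / qnorm E (y 0) * qnorm E ?f"
      using u by (intro coord_bound sum_car smult_car)
    moreover have "lower_const / qnorm E (y 0) * qnorm E ?f \<le>
        lower_const / qnorm E (y 0) * real (card F) powr (1 / q)"
      using le lower_const_pos qnorm_y_pos[of 0] by (intro mult_left_mono) auto
    ultimately show ?thesis using F(2) by simp
  qed
  then show False by (rule linear_not_le_powr[OF q \<delta>(1)])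
qed

text \<open>A gliding hump in the coefficients: sequences that are coordinatewise null and bounded
  below in \<open>\<ell>\<^sub>1\<close> contain almost disjointly supported ones, whose norms
  \<open>S\<close> add up to a fixed proportion.\<close>

lemma not_l1_bounded_if_lq_units:
  assumes q: "1 < q" and units: "lq_units E q u U" and K: "0 \<le> K"
    "\<And>f N. f \<in> car E \<Longrightarrow> (\<Sum>n<N. norm (coord E y n f)) \<le> K * qnorm E f"
  shows False
proof -
  have u: "u k \<in> car E" for k by (rule lq_unitsD(1)[OF units])
  define S where "S f = (\<Sum>n. norm (coord E y n f))" for f
  have summ: "summable (\<lambda>n. norm (coord E y n f))" if "f \<in> car E" for f
    using K(2)[OF that] by (intro bounded_imp_summable[where B = "K * qnorm E f"])
      (auto simp: lessThan_Suc_atMost[symmetric] simp del: sum.lessThan_Suc)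
  have S_le: "S f \<le> K * qnorm E f" if "f \<in> car E" for f
    unfolding S_def using K(2)[OF that] summ[OF that] by (intro suminf_le_const)
  define M where "M = C\<^sup>2 * qnorm E (y 0)"
  have M: "qnorm E (y n) \<le> M" for n unfolding M_def by (rule qnorm_y_le)
  have Mpos: "0 < M" using M[of 0] qnorm_y_pos[of 0] by linarith
  \<comment> \<open>The functional \<open>U k\<close> has modulus at most \<open>M\<close> on every
    basis vector, so on partial sums of \<open>u k\<close> it is dominated by
    \<open>M * S (u k)\<close>. The remainders vanish in the limit, and \<open>U k (u k) = 1\<close>
    forces the lower bound.\<close>
  have S_ge: "1 / M \<le> S (u k)" for k
  proof -
    let ?a = "\<lambda>n. coord E y n (u k)"
    have U_sum: "U k (comb ?a {..<N}) = (\<Sum>n<N. ?a n * U k (y n))" for N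
    proof -
      have U_add: "U k (f + g) = U k f + U k g" and U_smult: "U k (smult E c f) = c * U k f"
        for f g c by (fact lq_unitsD(3,4)[OF units])+
      have "U k 0 = 0" using U_add[of 0 0] by simp
      then show ?thesis
        unfolding comb_def by (induction N) (simp_all add: U_add U_smult)
    qed
    have "1 - M * S (u k) \<le> qnorm E (u k - comb ?a {..<N})" for N
    proof -
      have U_add: "U k (f + g) = U k f + U k g" for f g by (rule lq_unitsD(3)[OF units])
      have U_le: "norm (U k f) \<le> qnorm E f" if "f \<in> car E" for f
        using that by (rule lq_unitsD(5)[OF units])
      have "norm (U k (comb ?a {..<N})) \<le> (\<Sum>n<N. norm (?a n) * M)"
        unfolding U_sum
        by (intro sum_norm_le) (auto simp: norm_mult intro!: mult_left_mono order_trans[OF U_le M] y_car)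
      also have "\<dots> = M * (\<Sum>n<N. norm (?a n))" by (simp add: sum_distrib_left mult.commute)
      also have "\<dots> \<le> M * S (u k)"
        unfolding S_def using Mpos by (intro mult_left_mono sum_le_suminf summ u) auto
      finally have 1: "norm (U k (comb ?a {..<N})) \<le> M * S (u k)" .
      have "1 = U k (u k - comb ?a {..<N}) + U k (comb ?a {..<N})"
        using U_add[of "u k - comb ?a {..<N}" "comb ?a {..<N}"] by (simp add: lq_unitsD(6)[OF units])
      then have "1 \<le> norm (U k (u k - comb ?a {..<N})) + norm (U k (comb ?a {..<N}))"
        by (metis norm_one norm_triangle_ineq)
      moreover have "norm (U k (u k - comb ?a {..<N})) \<le> qnorm E (u k - comb ?a {..<N})"
        by (intro U_le diff_car u comb_car)
      ultimately show ?thesis using 1 by linarith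
    qed
    moreover have "(\<lambda>N. qnorm E (u k - comb ?a {..<N})) \<longlonglongrightarrow> 0"
      using expansion_coord[OF u] unfolding expansion_iff .
    ultimately have "1 - M * S (u k) \<le> 0"
      by (intro LIMSEQ_le_const) auto
    then show ?thesis using Mpos by (simp add: field_simps)
  qed
  \<comment> \<open>The head of a new vector has mass below \<open>\<eta>\<close> and counts twice,
    once as mass missing in the tail and once as disturbance of the old head. The tail of the old
    sum counts twice in the same way. Of the \<open>5 * \<eta>\<close> brought in, one
    \<open>\<eta>\<close> remains as gain.\<close>
  define \<eta> where "\<eta> = 1 / (5 * M)"
  have \<eta>: "0 < \<eta>" "5 * \<eta> \<le> S (u k)" for k using S_ge[of k] Mpos by (auto simp: \<eta>_def)
  have "\<exists>F. finite F \<and> card F = m \<and> real m * \<eta> \<le> S (\<Sum>k\<in>F. u k)" for m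
  proof (induction m)
    case 0
    then show ?case by (intro exI[of _ "{}"]) (simp add: S_def coord_zero)
  next
    case (Suc m)
    then obtain F where F: "finite F" "card F = m" "real m * \<eta> \<le> S (\<Sum>k\<in>F. u k)" by blast
    let ?f = "\<Sum>k\<in>F. u k"
    have f: "?f \<in> car E" by (intro sum_car u)
    let ?a = "\<lambda>n. norm (coord E y n ?f)"
    have "(\<lambda>N. \<Sum>n<N. ?a n) \<longlonglongrightarrow> S ?f"
      unfolding S_def by (rule summable_LIMSEQ[OF summ[OF f]])
    then have "\<forall>\<^sub>F N in sequentially. S ?f - \<eta> < (\<Sum>n<N. ?a n)"
      using \<eta>(1) by (intro order_tendstoD(1)) auto
    then obtain N where N: "S ?f - \<eta> < (\<Sum>n<N. ?a n)" by (auto simp: eventually_sequentially)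
    let ?b = "\<lambda>k n. norm (coord E y n (u k))"
    have "(\<lambda>k. \<Sum>n<N. ?b k n) \<longlonglongrightarrow> (\<Sum>n<N. norm (0::'k))"
      by (intro tendsto_intros lq_units_coord_tendsto_0[OF q units])
    then have "\<forall>\<^sub>F k in sequentially. (\<Sum>n<N. ?b k n) < \<eta>"
      using \<eta>(1) by (intro order_tendstoD(2)) auto
    moreover have "\<forall>\<^sub>F k in sequentially. k \<notin> F"
      using F(1) by (metis eventually_sequentiallyI finite_nat_set_iff_bounded not_less)
    ultimately have "\<forall>\<^sub>F k in sequentially. (\<Sum>n<N. ?b k n) < \<eta> \<and> k \<notin> F"
      by eventually_elim auto
    then obtain k where k: "(\<Sum>n<N. ?b k n) < \<eta>" "k \<notin> F"
      by (auto simp: eventually_sequentially)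
    have head_tail: "S g = (\<Sum>n<N. norm (coord E y n g)) + (\<Sum>n. norm (coord E y (n + N) g))"
      if "g \<in> car E" for g
      unfolding S_def using suminf_split_initial_segment[OF summ[OF that], of N] by simp
    have summ': "summable (\<lambda>n. norm (coord E y (n + N) g))" if "g \<in> car E" for g
      by (rule summable_ignore_initial_segment[OF summ[OF that]])
    let ?g = "?f + u k"
    have g: "?g \<in> car E" by (intro add_car f u)
    have "(\<Sum>n<N. ?a n - ?b k n) \<le> (\<Sum>n<N. norm (coord E y n ?g))"
    proof (intro sum_mono)
      fix n show "?a n - ?b k n \<le> norm (coord E y n ?g)"
        using norm_diff_ineq[of "coord E y n ?f" "coord E y n (u k)"] f u by (simp add: coord_add)
    qed
    moreover have "(\<Sum>n. ?b k (n + N) - ?a (n + N)) \<le> (\<Sum>n. norm (coord E y (n + N) ?g))"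
    proof (intro suminf_le summable_diff summ' f u g)
      fix n show "?b k (n + N) - ?a (n + N) \<le> norm (coord E y (n + N) ?g)"
        using norm_diff_ineq[of "coord E y (n + N) (u k)" "coord E y (n + N) ?f"] f u
        by (simp add: coord_add add.commute)
    qed
    then have "(\<Sum>n. ?b k (n + N)) - (\<Sum>n. ?a (n + N)) \<le> (\<Sum>n. norm (coord E y (n + N) ?g))"
      by (simp add: suminf_diff summ' f u)
    ultimately have "S ?f + \<eta> \<le> S ?g"
      using head_tail[OF f] head_tail[OF u[of k]] head_tail[OF g] N k(1) \<eta>(2)[of k]
      by (simp add: sum_subtractf)
    then show ?case
      using F k(2) by (intro exI[of _ "insert k F"]) (auto simp: algebra_simps)
  qed
  note F = this
  have "real m * \<eta> \<le> K * real m powr (1 / q)" for m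
  proof -
    obtain F where F: "finite F" "card F = m" "real m * \<eta> \<le> S (\<Sum>k\<in>F. u k)"
      using F by blast
    have "qnorm E (\<Sum>k\<in>F. smult E 1 (u k)) \<le> real (card F) powr (1 / q)"
      using F(1) by (intro lq_unitsD(2)[OF units]) auto
    then have "K * qnorm E (\<Sum>k\<in>F. u k) \<le> K * real m powr (1 / q)"
      using K(1) F(2) by (intro mult_left_mono) (auto simp: smult_one)
    moreover have "S (\<Sum>k\<in>F. u k) \<le> K * qnorm E (\<Sum>k\<in>F. u k)"
      by (intro S_le sum_car u)
    ultimately show ?thesis using F(3) by linarith
  qed
  then show False by (rule linear_not_le_powr[OF q \<eta>(1)])
qed

end

subsection \<open>The fundamental function\<close>

text \<open>Pairing consecutive terms cancels an entrywise limit. For injective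
  \<open>\<sigma>\<close> the result is a combination with coefficients \<plusminus>1 of terms with
  \<open>2 * card F\<close> distinct indices.\<close>

definition pair_sum :: "(nat \<Rightarrow> 'v::ab_group_add) \<Rightarrow> (nat \<Rightarrow> nat) \<Rightarrow> nat set \<Rightarrow> 'v" where
  "pair_sum x \<sigma> F = (\<Sum>k\<in>F. x (\<sigma> (2 * k)) - x (\<sigma> (2 * k + 1)))"

text \<open>The additive constants \<open>D\<close> absorb perturbations; they do no harm since the fundamental function of
  an almost greedy basis is bounded below.\<close>

definition difference_dichotomy ::
    "('k, 'v::ab_group_add) qnspace \<Rightarrow> real \<Rightarrow> real \<Rightarrow> bool" where
  "difference_dichotomy E p q \<longleftrightarrow>
     (\<forall>x c M. (\<forall>n. x n \<in> car E \<and> qnorm E (x n) \<le> M) \<longrightarrow> 0 < c \<longrightarrow>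
        (\<forall>i j. i \<noteq> j \<longrightarrow> c \<le> qnorm E (x i - x j)) \<longrightarrow>
        (\<exists>\<sigma>. inj \<sigma> \<and>
          ((\<exists>c>0. \<exists>D. \<forall>m. \<exists>F. finite F \<and> card F = m \<and>
              c * real m powr (1 / p) \<le> qnorm E (pair_sum x \<sigma> F) + D) \<or>
           (\<exists>c>0. \<exists>D K. \<forall>m. \<exists>F. finite F \<and> card F = m \<and>
              c * real m powr (1 / q) \<le> qnorm E (pair_sum x \<sigma> F) + D \<and>
              qnorm E (pair_sum x \<sigma> F) \<le> K * real m powr (1 / q) + D))))"

context almost_greedy
begin

text \<open>The i-th coefficient of \<open>y i - y j\<close> is 1, and coefficients are bounded by
  the quasi-norm. Together with \<open>qnorm_y_le\<close> this makes the basis admissible in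
  \<open>difference_dichotomy\<close>.\<close>

lemma y_separated:
  assumes "i \<noteq> j"
  shows "qnorm E (y 0) / lower_const \<le> qnorm E (y i - y j)"
proof -
  let ?c = "\<lambda>n. if n = i then 1 else - 1"
  have eq: "y i - y j = comb ?c {i, j}"
    using assms by (simp add: comb_def smult_one smult_minus_one)
  have "norm (coord E y i (y i - y j)) \<le> lower_const / qnorm E (y 0) * qnorm E (y i - y j)"
    by (intro coord_bound diff_car y_car)
  moreover have "coord E y i (y i - y j) = 1"
    unfolding eq by (subst coord_comb) auto
  ultimately show ?thesis
    using lower_const_pos qnorm_y_pos[of 0] by (simp add: field_simps)
qed

lemma pair_sum_eq_comb:
  assumes "finite F" "inj \<sigma>"
  shows "pair_sum y \<sigma> F = comb (\<lambda>_. 1) ((\<lambda>k. \<sigma> (2 * k)) ` F) - comb (\<lambda>_. 1) ((\<lambda>k. \<sigma> (2 * k + 1)) ` F)"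
proof -
  have "inj_on (\<lambda>k. \<sigma> (2 * k)) F" "inj_on (\<lambda>k. \<sigma> (2 * k + 1)) F"
    by (auto intro!: inj_onI dest!: injD[OF assms(2)])
  then show ?thesis
    unfolding pair_sum_def comb_def by (simp add: sum.reindex sum_subtractf smult_one)
qed

text \<open>Both halves of the pair sum have at most \<open>card B\<close> terms, which gives
  \<open>2 * \<kappa> * C\<^sup>2\<close>. The additive \<open>D\<close> is absorbed because the
  right-hand combination is nonempty and thus, by democracy, not smaller than \<open>y 0\<close> up
  to \<open>C\<^sup>2\<close>.\<close>

lemma qnorm_comb_lower:
  assumes F: "finite F" "inj \<sigma>" and B: "finite B" "1 \<le> card B" "card F \<le> card B"
    "\<And>n. n \<in> B \<Longrightarrow> norm (\<delta> n) = 1"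
  shows "qnorm E (pair_sum y \<sigma> F) + D \<le>
      (2 * \<kappa> * C\<^sup>2 + \<bar>D\<bar> * C\<^sup>2 / qnorm E (y 0)) * qnorm E (comb \<delta> B)"
proof -
  have dem: "qnorm E (comb (\<lambda>_. 1) A) \<le> C\<^sup>2 * qnorm E (comb \<delta> B)"
    if "finite A" "card A \<le> card B" for A
    using that B by (intro democratic) auto
  have "qnorm E (pair_sum y \<sigma> F) \<le> \<kappa> * (qnorm E (comb (\<lambda>_. 1) ((\<lambda>k. \<sigma> (2 * k)) ` F)) +
      qnorm E (comb (\<lambda>_. 1) ((\<lambda>k. \<sigma> (2 * k + 1)) ` F)))"
    unfolding pair_sum_eq_comb[OF F] by (intro qnorm_diff comb_car)
  also have "\<dots> \<le> \<kappa> * (C\<^sup>2 * qnorm E (comb \<delta> B) + C\<^sup>2 * qnorm E (comb \<delta> B))"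
    using F(1) kappa B(3)
    by (intro mult_left_mono add_mono dem) (auto intro: order_trans[OF card_image_le])
  finally have 1: "qnorm E (pair_sum y \<sigma> F) \<le> 2 * \<kappa> * C\<^sup>2 * qnorm E (comb \<delta> B)"
    by (simp add: algebra_simps)
  have "qnorm E (y 0) \<le> C\<^sup>2 * qnorm E (comb \<delta> B)"
    using dem[of "{0}"] B(2) by (simp add: comb_def smult_one)
  then have "1 \<le> C\<^sup>2 / qnorm E (y 0) * qnorm E (comb \<delta> B)"
    using qnorm_y_pos[of 0] by (simp add: field_simps)
  then have "\<bar>D\<bar> \<le> \<bar>D\<bar> * (C\<^sup>2 / qnorm E (y 0) * qnorm E (comb \<delta> B))"
    using mult_left_mono[of 1 "C\<^sup>2 / qnorm E (y 0) * qnorm E (comb \<delta> B)" "\<bar>D\<bar>"] by simp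
  then have "D \<le> \<bar>D\<bar> * C\<^sup>2 / qnorm E (y 0) * qnorm E (comb \<delta> B)" by simp
  with 1 show ?thesis by (simp add: distrib_right)
qed

text \<open>The pair sum is itself a combination with coefficients \<plusminus>1 over a set with at
  least \<open>card F\<close> elements, so democracy applies to it directly.\<close>

lemma qnorm_comb_upper:
  assumes F: "finite F" "inj \<sigma>" and A: "finite A" "card A \<le> card F"
    "\<And>n. n \<in> A \<Longrightarrow> norm (\<epsilon> n) = 1"
  shows "qnorm E (comb \<epsilon> A) \<le> C\<^sup>2 * qnorm E (pair_sum y \<sigma> F)"
proof -
  let ?A = "(\<lambda>k. \<sigma> (2 * k)) ` F" and ?B = "(\<lambda>k. \<sigma> (2 * k + 1)) ` F"
  have disj: "?A \<inter> ?B = {}"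
  proof -
    have "2 * k \<noteq> 2 * l + 1" for k l :: nat by presburger
    then show ?thesis using F(2) by (auto simp: inj_eq)
  qed
  let ?\<delta> = "\<lambda>n. if n \<in> ?A then 1 else - 1"
  have "comb ?\<delta> ?B = comb (\<lambda>n. - 1 * 1) ?B"
    using disj by (intro comb_cong) auto
  also have "\<dots> = - comb (\<lambda>n. 1) ?B" by (simp only: comb_smult smult_minus_one)
  finally have eq: "comb ?\<delta> (?A \<union> ?B) = pair_sum y \<sigma> F"
    using F disj comb_cong[of ?A ?\<delta> "\<lambda>n. 1"] by (simp add: comb_union pair_sum_eq_comb)
  have "card F = card ?A" by (subst card_image) (auto intro!: inj_onI dest!: injD[OF F(2)])
  also have "\<dots> \<le> card (?A \<union> ?B)" using F(1) by (intro card_mono) auto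
  finally have "qnorm E (comb \<epsilon> A) \<le> C\<^sup>2 * qnorm E (comb ?\<delta> (?A \<union> ?B))"
    using A F by (intro democratic) auto
  then show ?thesis unfolding eq .
qed

lemma fundamental_function_comb:
  "fundamental_function E y m =
     Sup {ereal (qnorm E (comb \<epsilon> A)) | A \<epsilon>. finite A \<and> card A \<le> m \<and> (\<forall>n\<in>A. norm (\<epsilon> n) = 1)}"
  unfolding fundamental_function_def comb_def ..

theorem fundamental_function_equivalent:
  assumes p: "0 < p" "p < 1" and q: "1 < q"
    and units: "lq_units E q u U" and dich: "difference_dichotomy E p q"
  shows "equivalent_up_to_const (fundamental_function E y) (\<lambda>m. real m powr (1 / q))"
proof -
  have "\<forall>n. y n \<in> car E \<and> qnorm E (y n) \<le> C\<^sup>2 * qnorm E (y 0)"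
    using y_car qnorm_y_le by blast
  moreover have "0 < qnorm E (y 0) / lower_const"
    using qnorm_y_pos lower_const_pos by simp
  moreover have "\<forall>i j. i \<noteq> j \<longrightarrow> qnorm E (y 0) / lower_const \<le> qnorm E (y i - y j)"
    using y_separated by blast
  ultimately have "\<exists>\<sigma>. inj \<sigma> \<and>
          ((\<exists>c>0. \<exists>D. \<forall>m. \<exists>F. finite F \<and> card F = m \<and>
                c * real m powr (1 / p) \<le> qnorm E (pair_sum y \<sigma> F) + D) \<or>
           (\<exists>c>0. \<exists>D K. \<forall>m. \<exists>F. finite F \<and> card F = m \<and>
              c * real m powr (1 / q) \<le> qnorm E (pair_sum y \<sigma> F) + D \<and>
              qnorm E (pair_sum y \<sigma> F) \<le> K * real m powr (1 / q) + D))" (is "\<exists>\<sigma>. inj \<sigma> \<and> ?P \<sigma>")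
    by (rule dich[unfolded difference_dichotomy_def, THEN spec, THEN spec, THEN spec, THEN mp, THEN mp, THEN mp])
  then obtain \<sigma> where \<sigma>: "inj \<sigma>" and dis: "?P \<sigma>"
    by (elim exE conjE) (rule that)
  define L where "L D = 2 * \<kappa> * C\<^sup>2 + \<bar>D\<bar> * C\<^sup>2 / qnorm E (y 0)" for D
  have L: "0 < L D" for D
    using kappa C qnorm_y_pos[of 0] unfolding L_def by (intro add_pos_nonneg) auto
  from dis show ?thesis
  proof (elim disjE exE conjE)
    fix c D :: real
    assume c: "0 < c" and low: "\<forall>m. \<exists>F. finite F \<and> card F = m \<and>
        c * real m powr (1 / p) \<le> qnorm E (pair_sum y \<sigma> F) + D"
    have "\<exists>A \<epsilon>. finite A \<and> card A = m \<and> (\<forall>n\<in>A. norm (\<epsilon> n) = 1) \<and>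
        c / L D * real m powr (1 / p) \<le> qnorm E (comb \<epsilon> A)" for m
    proof (cases "m = 0")
      case True
      then show ?thesis by (intro exI[of _ "{}"]) (simp add: comb_def)
    next
      case False
      obtain F where F: "finite F" "card F = m" "c * real m powr (1 / p) \<le> qnorm E (pair_sum y \<sigma> F) + D"
        using low by blast
      note F(3)
      also have "qnorm E (pair_sum y \<sigma> F) + D \<le> L D * qnorm E (comb (\<lambda>_. 1) {..<m})"
        unfolding L_def using F False \<sigma> by (intro qnorm_comb_lower) auto
      finally have "c / L D * real m powr (1 / p) \<le> qnorm E (comb (\<lambda>_. 1) {..<m})"
        using L[of D] by (simp add: field_simps)
      then show ?thesis by (intro exI[of _ "{..<m}"] exI[of _ "\<lambda>_. 1"]) auto
    qed
    \<comment> \<open>The first alternative is contradictory, so the claim follows from it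
      trivially; only the second one describes an actual basis.\<close>
    from sum_coord_bound[OF p _ this] not_l1_bounded_if_lq_units[OF q units]
    show ?thesis using c L[of D] by (metis divide_pos_pos)
  next
    fix c D K :: real
    assume c: "0 < c" and est: "\<forall>m. \<exists>F. finite F \<and> card F = m \<and>
        c * real m powr (1 / q) \<le> qnorm E (pair_sum y \<sigma> F) + D \<and>
        qnorm E (pair_sum y \<sigma> F) \<le> K * real m powr (1 / q) + D"
    \<comment> \<open>Democracy contributes \<open>C\<^sup>2\<close>. The additive \<open>D\<close>
      is absorbed since \<open>m powr (1 / q)\<close> is at least 1, and the summand 1 keeps the
      constant positive.\<close>
    let ?K = "C\<^sup>2 * (\<bar>K\<bar> + \<bar>D\<bar> + 1)"
    have "ereal (c / L D * real m powr (1 / q)) \<le> fundamental_function E y m \<and>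
        fundamental_function E y m \<le> ereal (?K * real m powr (1 / q))" if m: "1 \<le> m" for m
    proof
      obtain F where F: "finite F" "card F = m"
        "c * real m powr (1 / q) \<le> qnorm E (pair_sum y \<sigma> F) + D"
        "qnorm E (pair_sum y \<sigma> F) \<le> K * real m powr (1 / q) + D"
        using est by blast
      note F(3)
      also have "qnorm E (pair_sum y \<sigma> F) + D \<le> L D * qnorm E (comb (\<lambda>_. 1) {..<m})"
        unfolding L_def using F m \<sigma> by (intro qnorm_comb_lower) auto
      finally have "c / L D * real m powr (1 / q) \<le> qnorm E (comb (\<lambda>_. 1) {..<m})"
        using L[of D] by (simp add: field_simps)
      moreover have "ereal (qnorm E (comb (\<lambda>_. 1) {..<m})) \<le> fundamental_function E y m"
        unfolding fundamental_function_comb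
        by (intro Sup_upper CollectI exI[of _ "{..<m}"] exI[of _ "\<lambda>_. 1"]) simp
      ultimately show "ereal (c / L D * real m powr (1 / q)) \<le> fundamental_function E y m"
        by (meson ereal_less_eq(3) order_trans)
      have one: "1 \<le> real m powr (1 / q)" using m q by (intro ge_one_powr_ge_zero) auto
      have "D \<le> \<bar>D\<bar> * real m powr (1 / q)"
        using mult_left_mono[OF one, of "\<bar>D\<bar>"] by simp
      moreover have "K * real m powr (1 / q) \<le> \<bar>K\<bar> * real m powr (1 / q)"
        by (intro mult_right_mono) auto
      ultimately have "qnorm E (pair_sum y \<sigma> F) \<le> (\<bar>K\<bar> + \<bar>D\<bar> + 1) * real m powr (1 / q)"
        using F(4) one by (simp add: distrib_right)
      then have "C\<^sup>2 * qnorm E (pair_sum y \<sigma> F) \<le> ?K * real m powr (1 / q)"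
        by (simp add: mult_left_mono mult.assoc)
      moreover have "qnorm E (comb \<epsilon> A) \<le> C\<^sup>2 * qnorm E (pair_sum y \<sigma> F)"
        if "finite A" "card A \<le> m" "\<forall>n\<in>A. norm (\<epsilon> n) = 1" for A \<epsilon>
        using that F \<sigma> by (intro qnorm_comb_upper) auto
      ultimately show "fundamental_function E y m \<le> ereal (?K * real m powr (1 / q))"
        unfolding fundamental_function_comb by (intro Sup_least) force
    qed
    moreover have "0 < c / L D" "0 < ?K" using c L C by (auto simp: zero_less_mult_iff)
    ultimately show ?thesis unfolding equivalent_up_to_const_def by blast
  qed
qed

end

lemma almost_greedy_basis_fundamental_function:
  assumes "quasi_normed E \<kappa>" "almost_greedy_basis E y" "0 < p" "p < 1" "1 < q"
    "lq_units E q u U" "difference_dichotomy E p q"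
  shows "equivalent_up_to_const (fundamental_function E y) (\<lambda>m. real m powr (1 / q))"
proof -
  interpret quasi_normed E \<kappa> by fact
  obtain C where C: "schauder_basis E y"
    "\<forall>f\<in>car E. \<forall>A B. greedy_set E y f A \<longrightarrow> finite B \<longrightarrow> card B \<le> card A \<longrightarrow>
        qnorm E (f - basis_proj E y A f) \<le> C * qnorm E (f - basis_proj E y B f)"
    using assms(2) unfolding almost_greedy_basis_def by blast
  \<comment> \<open>The constant in the definition may be any real number; as quasi-norms are
    nonnegative, it can be enlarged to be at least 1.\<close>
  interpret almost_greedy E \<kappa> y "max 1 C"
  proof
    fix f and A B :: "nat set"
    assume "f \<in> car E" "greedy_set E y f A" "finite B" "card B \<le> card A"
    then have "qnorm E (f - basis_proj E y A f) \<le> C * qnorm E (f - basis_proj E y B f)"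
      using C(2) by blast
    also have "\<dots> \<le> max 1 C * qnorm E (f - basis_proj E y B f)"
      by (intro mult_right_mono qnorm_nonneg) auto
    finally show "qnorm E (f - basis_proj E y A f) \<le> max 1 C * qnorm E (f - basis_proj E y B f)" .
  qed (use C in auto)
  show ?thesis using assms by (intro fundamental_function_equivalent)
qed

subsection \<open>The concrete spaces\<close>

lemma powr_add_le:
  fixes a b r :: real
  assumes "0 \<le> a" "0 \<le> b" "0 < r"
  shows "(a + b) powr r \<le> 2 powr r * (a powr r + b powr r)"
proof -
  have "(a + b) powr r \<le> (2 * max a b) powr r"
    using assms by (intro powr_mono2) auto
  also have "\<dots> = 2 powr r * max a b powr r"
    using assms by (simp add: powr_mult)
  also have "\<dots> \<le> 2 powr r * (a powr r + b powr r)"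
    by (intro mult_left_mono) (auto simp: max_def)
  finally show ?thesis .
qed

lemma lr_sum_simps:
  "car (lr_sum r E) = {f. (\<forall>n. f n \<in> car (E n)) \<and> summable (\<lambda>n. qnorm (E n) (f n) powr r)}"
  "smult (lr_sum r E) c f = (\<lambda>n. smult (E n) c (f n))"
  "qnorm (lr_sum r E) f = (\<Sum>n. qnorm (E n) (f n) powr r) powr (1 / r)"
  unfolding lr_sum_def by simp_all

text \<open>The crude inequality \<open>powr_add_le\<close> is applied with exponent
  \<open>r\<close> in every row, which costs 2, and with exponent \<open>1 / r\<close> to the two
  sums, which costs \<open>2 powr (1 / r)\<close>. This treats exponents below and above 1
  alike.\<close>

lemma quasi_normed_lr_sum:
  assumes E: "\<And>n. quasi_normed (E n) \<kappa>" and r: "0 < r"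
  shows "quasi_normed (lr_sum r E) (\<kappa> * 2 * 2 powr (1 / r))"
proof -
  interpret E: quasi_normed "E n" \<kappa> for n by (rule E)
  have le: "qnorm (E n) (f n + g n) powr r \<le>
      (\<kappa> * 2) powr r * (qnorm (E n) (f n) powr r + qnorm (E n) (g n) powr r)"
    if "f n \<in> car (E n)" "g n \<in> car (E n)" for f g n
  proof -
    have "qnorm (E n) (f n + g n) powr r \<le> (\<kappa> * (qnorm (E n) (f n) + qnorm (E n) (g n))) powr r"
      using E.qnorm_add[OF that] r by (intro powr_mono2) (auto simp: E.qnorm_nonneg)
    also have "\<dots> = \<kappa> powr r * (qnorm (E n) (f n) + qnorm (E n) (g n)) powr r"
      using E.kappa by (simp add: powr_mult E.qnorm_nonneg)
    also have "\<dots> \<le> \<kappa> powr r * (2 powr r * (qnorm (E n) (f n) powr r + qnorm (E n) (g n) powr r))"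
      using r by (intro mult_left_mono powr_add_le) (auto simp: E.qnorm_nonneg)
    finally show ?thesis using E.kappa by (simp add: powr_mult mult.assoc)
  qed
  have summ: "summable (\<lambda>n. (\<kappa> * 2) powr r * (qnorm (E n) (f n) powr r + qnorm (E n) (g n) powr r))"
    if "f \<in> car (lr_sum r E)" "g \<in> car (lr_sum r E)" for f g
    using that by (intro summable_mult summable_add) (auto simp: lr_sum_simps)
  have summ_add: "summable (\<lambda>n. qnorm (E n) (f n + g n) powr r)"
    if "f \<in> car (lr_sum r E)" "g \<in> car (lr_sum r E)" for f g
    using that le[of f _ g]
    by (intro summable_comparison_test'[OF summ[OF that]]) (auto simp: lr_sum_simps)
  have smult_powr: "qnorm (E n) (smult (E n) c (f n)) powr r = norm c powr r * qnorm (E n) (f n) powr r"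
    if "f n \<in> car (E n)" for c f n
    using that by (simp add: E.qnorm_smult powr_mult E.qnorm_nonneg)
  show ?thesis
  proof
    show "1 \<le> \<kappa> * 2 * 2 powr (1 / r)"
      using E.kappa ge_one_powr_ge_zero[of 2 "1 / r"] r
      by (intro mult_ge1_I[of "\<kappa> * 2", simplified mult_ac] mult_ge1_I) auto
    show "0 \<in> car (lr_sum r E)"
      by (simp add: lr_sum_simps E.zero_car)
    show "f + g \<in> car (lr_sum r E)" if "f \<in> car (lr_sum r E)" "g \<in> car (lr_sum r E)" for f g
      using that summ_add[OF that] by (auto simp: lr_sum_simps E.add_car)
    show "smult (lr_sum r E) c f \<in> car (lr_sum r E)" if "f \<in> car (lr_sum r E)" for c f
      using that by (auto simp: lr_sum_simps E.smult_car smult_powr intro: summable_mult)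
    show "smult (lr_sum r E) c (f + g) = smult (lr_sum r E) c f + smult (lr_sum r E) c g" for c f g
      by (simp add: lr_sum_simps E.smult_add_right fun_eq_iff)
    show "smult (lr_sum r E) (c + d) f = smult (lr_sum r E) c f + smult (lr_sum r E) d f" for c d f
      by (simp add: lr_sum_simps E.smult_add_left fun_eq_iff)
    show "smult (lr_sum r E) c (smult (lr_sum r E) d f) = smult (lr_sum r E) (c * d) f" for c d f
      by (simp add: lr_sum_simps E.smult_assoc)
    show "smult (lr_sum r E) 1 f = f" for f
      by (simp add: lr_sum_simps E.smult_one)
    show "0 \<le> qnorm (lr_sum r E) f" for f
      by (simp add: lr_sum_simps)
    show "qnorm (lr_sum r E) (smult (lr_sum r E) c f) = norm c * qnorm (lr_sum r E) f"
      if "f \<in> car (lr_sum r E)" for c f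
      using that r by (simp add: lr_sum_simps smult_powr suminf_mult powr_mult suminf_nonneg powr_powr)
    show "f = 0" if f: "f \<in> car (lr_sum r E)" and 0: "qnorm (lr_sum r E) f = 0" for f
    proof
      fix n
      have "(\<Sum>n. qnorm (E n) (f n) powr r) = 0"
        using 0 by (simp add: lr_sum_simps)
      then have "qnorm (E n) (f n) powr r = 0"
        using f by (subst (asm) suminf_eq_zero_iff) (auto simp: lr_sum_simps)
      then show "f n = 0 n"
        using f E.qnorm_zero_imp[of "f n" n] by (auto simp: lr_sum_simps)
    qed
    show "qnorm (lr_sum r E) (f + g) \<le>
        \<kappa> * 2 * 2 powr (1 / r) * (qnorm (lr_sum r E) f + qnorm (lr_sum r E) g)"
      if fg: "f \<in> car (lr_sum r E)" "g \<in> car (lr_sum r E)" for f g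
    proof -
      let ?A = "\<Sum>n. qnorm (E n) (f n) powr r" and ?B = "\<Sum>n. qnorm (E n) (g n) powr r"
      have AB: "0 \<le> ?A" "0 \<le> ?B"
        using fg by (auto simp: lr_sum_simps intro: suminf_nonneg)
      have "(\<Sum>n. qnorm (E n) (f n + g n) powr r) \<le>
          (\<Sum>n. (\<kappa> * 2) powr r * (qnorm (E n) (f n) powr r + qnorm (E n) (g n) powr r))"
        using fg le[of f _ g] by (intro suminf_le summ_add summ) (auto simp: lr_sum_simps)
      also have "\<dots> = (\<kappa> * 2) powr r * (?A + ?B)"
        using fg by (subst suminf_mult) (auto simp: lr_sum_simps suminf_add intro: summable_add)
      finally have "qnorm (lr_sum r E) (f + g) \<le> ((\<kappa> * 2) powr r * (?A + ?B)) powr (1 / r)"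
        using r summ_add[OF fg] by (auto simp: lr_sum_simps intro!: powr_mono2 suminf_nonneg)
      also have "\<dots> = \<kappa> * 2 * (?A + ?B) powr (1 / r)"
        using r AB E.kappa by (simp add: powr_mult powr_powr)
      also have "\<dots> \<le> \<kappa> * 2 * (2 powr (1 / r) * (?A powr (1 / r) + ?B powr (1 / r)))"
        using r AB E.kappa by (intro mult_left_mono powr_add_le) auto
      finally show ?thesis by (simp add: lr_sum_simps mult.assoc)
    qed
  qed
qed

lemma qnorm_le_qnorm_lr_sum:
  assumes "f \<in> car (lr_sum r E)" "0 < r" "0 \<le> qnorm (E n) (f n)"
  shows "qnorm (E n) (f n) \<le> qnorm (lr_sum r E) f"
proof -
  have "(\<Sum>n\<in>{n}. qnorm (E n) (f n) powr r) \<le> (\<Sum>n. qnorm (E n) (f n) powr r)"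
    using assms by (intro sum_le_suminf) (auto simp: lr_sum_simps)
  then have "(qnorm (E n) (f n) powr r) powr (1 / r) \<le> qnorm (lr_sum r E) f"
    using assms(2) unfolding lr_sum_simps by (intro powr_mono2) auto
  then show ?thesis using assms by (simp add: powr_powr)
qed

text \<open>With these summands \<open>\<ell>\<^sub>p\<close> is itself an \<open>lr_sum\<close>, so
  that one lemma yields the quasi-norm axioms at both levels of a mixed-norm space.\<close>

definition scalar_space :: "('k::{real_normed_field,euclidean_space}, 'k) qnspace" where
  "scalar_space = \<lparr> car = UNIV, smult = (*), qnorm = norm \<rparr>"

lemma quasi_normed_scalar_space: "quasi_normed scalar_space 1"
  by unfold_locales (auto simp: scalar_space_def algebra_simps norm_mult norm_triangle_ineq)

lemma lp_eq_lr_sum: "lp p = lr_sum p (\<lambda>_. scalar_space)"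
  unfolding lp_def lr_sum_def scalar_space_def by simp

lemma lp_simps:
  "car (lp p) = {x. summable (\<lambda>j. norm (x j) powr p)}"
  "smult (lp p) c x = (\<lambda>j. c * x j)"
  "qnorm (lp p) x = (\<Sum>j. norm (x j) powr p) powr (1 / p)"
  unfolding lp_def by simp_all

lemma quasi_normed_lp:
  assumes "0 < p"
  shows "\<exists>\<kappa>. quasi_normed (lp p :: ('k::{real_normed_field,euclidean_space}, _) qnspace) \<kappa>"
proof
  show "quasi_normed (lp p :: ('k, _) qnspace) (1 * 2 * 2 powr (1 / p))"
    unfolding lp_eq_lr_sum by (intro quasi_normed_lr_sum quasi_normed_scalar_space assms)
qed

lemma quasi_normed_lr_of_ls:
  assumes "0 < r" "0 < s"
  shows "\<exists>\<kappa>. quasi_normed (lr_of_ls r s) \<kappa>"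
  unfolding lr_of_ls_def using quasi_normed_lp[OF assms(2)] quasi_normed_lr_sum[OF _ assms(1)] by metis

lemma quasi_normed_subspace:
  assumes "quasi_normed F \<kappa>" "car E \<subseteq> car F" "\<And>c f. smult E c f = smult F c f"
    "\<And>f. f \<in> car E \<Longrightarrow> qnorm E f = qnorm F f" "\<And>f. 0 \<le> qnorm E f" "0 \<in> car E"
    "\<And>f g. f \<in> car E \<Longrightarrow> g \<in> car E \<Longrightarrow> f + g \<in> car E"
    "\<And>f c. f \<in> car E \<Longrightarrow> smult E c f \<in> car E"
  shows "quasi_normed E \<kappa>"
proof -
  interpret F: quasi_normed F \<kappa> by fact
  show ?thesis
    using assms(2)
    by unfold_locales
      (auto simp: assms(3-7) assms(8)[unfolded assms(3)] F.kappa F.smult_add_left F.smult_add_right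
         F.smult_assoc F.smult_one subset_iff F.qnorm_zero_imp F.qnorm_add F.qnorm_smult)
qed

lemma lp_dim_simps:
  "car (lp_dim p n) = {x. \<forall>j\<ge>n. x j = 0}"
  "smult (lp_dim p n) c x = (\<lambda>j. c * x j)"
  "qnorm (lp_dim p n) x = (\<Sum>j<n. norm (x j) powr p) powr (1 / p)"
  unfolding lp_dim_def by simp_all

lemma lp_dim_subspace:
  assumes "x \<in> car (lp_dim p n)"
  shows "x \<in> car (lp p)" "qnorm (lp p) x = qnorm (lp_dim p n) x"
proof -
  have 0: "norm (x j) powr p = 0" if "j \<notin> {..<n}" for j
    using assms that by (simp add: lp_dim_simps)
  show "x \<in> car (lp p)"
    unfolding lp_simps using 0 by (intro CollectI summable_finite[of "{..<n}"]) auto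
  show "qnorm (lp p) x = qnorm (lp_dim p n) x"
    unfolding lp_simps lp_dim_simps using 0 by (subst suminf_finite[of "{..<n}"]) auto
qed

text \<open>The constant is that of the whole of \<open>\<ell>\<^sub>p\<close>, independent of
  \<open>n\<close>; \<open>quasi_normed_lr_sum\<close> asks for one constant common to all
  summands.\<close>

lemma quasi_normed_lp_dim:
  assumes "quasi_normed (lp p :: ('k::{real_normed_field,euclidean_space}, _) qnspace) \<kappa>"
  shows "quasi_normed (lp_dim p n :: ('k, _) qnspace) \<kappa>"
proof (rule quasi_normed_subspace[OF assms])
  show "qnorm (lp_dim p n) f = qnorm (lp p) f" if "f \<in> car (lp_dim p n)" for f :: "nat \<Rightarrow> 'k"
    using lp_dim_subspace(2)[OF that] by simp
qed (auto simp: lp_dim_subspace(1), auto simp: lp_dim_simps lp_simps)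

lemma quasi_normed_lq_sum_lp_dims:
  assumes "0 < p" "0 < q"
  shows "\<exists>\<kappa>. quasi_normed (lq_sum_lp_dims q p :: ('k::{real_normed_field,euclidean_space}, _) qnspace) \<kappa>"
proof -
  obtain \<kappa> where "quasi_normed (lp p :: ('k, _) qnspace) \<kappa>" using quasi_normed_lp assms by blast
  then have "quasi_normed (lq_sum_lp_dims q p :: ('k, _) qnspace) (\<kappa> * 2 * 2 powr (1 / q))"
    unfolding lq_sum_lp_dims_def by (intro quasi_normed_lr_sum quasi_normed_lp_dim assms)
  then show ?thesis by blast
qed

lemma lq_sum_lp_dims_subspace:
  assumes "f \<in> car (lq_sum_lp_dims q p)"
  shows "f \<in> car (lr_of_ls q p)" "qnorm (lr_of_ls q p) f = qnorm (lq_sum_lp_dims q p) f"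
proof -
  have "f n \<in> car (lp_dim p (Suc n))" for n
    using assms by (simp add: lq_sum_lp_dims_def lr_sum_simps)
  note sub = lp_dim_subspace[OF this]
  show "f \<in> car (lr_of_ls q p)" "qnorm (lr_of_ls q p) f = qnorm (lq_sum_lp_dims q p) f"
    using assms by (auto simp: lq_sum_lp_dims_def lr_of_ls_def lr_sum_simps sub)
qed

lemma direct_sum_simps:
  "car (direct_sum E F) = car E \<times> car F"
  "smult (direct_sum E F) c z = (smult E c (fst z), smult F c (snd z))"
  "qnorm (direct_sum E F) z = qnorm E (fst z) + qnorm F (snd z)"
  unfolding direct_sum_def by simp_all

lemma quasi_normed_direct_sum:
  assumes "quasi_normed E \<kappa>" "quasi_normed F \<kappa>'"
  shows "quasi_normed (direct_sum E F) (max \<kappa> \<kappa>')"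
proof -
  interpret E: quasi_normed E \<kappa> by fact
  interpret F: quasi_normed F \<kappa>' by fact
  show ?thesis
  proof
    show "1 \<le> max \<kappa> \<kappa>'" using E.kappa by simp
    show "f = 0" if "f \<in> car (direct_sum E F)" "qnorm (direct_sum E F) f = 0" for f
      using that E.qnorm_nonneg[of "fst f"] F.qnorm_nonneg[of "snd f"]
        E.qnorm_zero_imp[of "fst f"] F.qnorm_zero_imp[of "snd f"]
      by (auto simp: direct_sum_simps prod_eq_iff)
    show "qnorm (direct_sum E F) (f + g) \<le>
        max \<kappa> \<kappa>' * (qnorm (direct_sum E F) f + qnorm (direct_sum E F) g)"
      if "f \<in> car (direct_sum E F)" "g \<in> car (direct_sum E F)" for f g
    proof -
      have "qnorm E (fst f + fst g) \<le> max \<kappa> \<kappa>' * (qnorm E (fst f) + qnorm E (fst g))"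
        using that by (intro order_trans[OF E.qnorm_add] mult_right_mono)
          (auto simp: direct_sum_simps E.qnorm_nonneg)
      moreover have "qnorm F (snd f + snd g) \<le> max \<kappa> \<kappa>' * (qnorm F (snd f) + qnorm F (snd g))"
        using that by (intro order_trans[OF F.qnorm_add] mult_right_mono)
          (auto simp: direct_sum_simps F.qnorm_nonneg)
      ultimately show ?thesis by (simp add: direct_sum_simps algebra_simps)
    qed
  qed (auto simp: direct_sum_simps prod_eq_iff mem_Times_iff E.zero_car F.zero_car E.add_car F.add_car
      E.smult_car F.smult_car E.smult_add_left F.smult_add_left E.smult_add_right F.smult_add_right
      E.smult_assoc F.smult_assoc E.smult_one F.smult_one E.qnorm_nonneg F.qnorm_nonneg
      E.qnorm_smult F.qnorm_smult algebra_simps)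
qed

lemma quasi_normed_lp_plus_lq:
  assumes "0 < p" "0 < q"
  shows "\<exists>\<kappa>. quasi_normed (lp_plus_lq p q) \<kappa>"
  unfolding lp_plus_lq_def using quasi_normed_lp assms quasi_normed_direct_sum by metis

subsection \<open>Copies of the unit vectors of \<open>\<ell>\<^sub>q\<close>\<close>

lemma sum_fun_apply: "(\<Sum>i\<in>A. f i) x = (\<Sum>i\<in>A. f i x)"
  by (induction A rule: infinite_finite_induct) auto

text \<open>One vector \<open>v\<close> is copied into every row. A combination over
  \<open>F\<close> then has rows of norm at most 1 on \<open>F\<close> and 0 elsewhere, and
  \<open>V\<close> applied to row \<open>k\<close> is the functional belonging to the k-th
  copy.\<close>

lemma lq_units_lr_sum:
  assumes q: "0 < q" and E: "\<And>n. quasi_normed (E n) \<kappa>"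
    and v: "\<And>n. v \<in> car (E n)" "\<And>n. qnorm (E n) v \<le> 1"
    and V: "\<And>f g. V (f + g) = V f + V g" "\<And>n c f. V (smult (E n) c f) = c * V f"
      "\<And>n f. f \<in> car (E n) \<Longrightarrow> norm (V f) \<le> qnorm (E n) f" "V v = 1"
  shows "lq_units (lr_sum q E) q (\<lambda>k n. if n = k then v else 0) (\<lambda>k f. V (f k))"
proof -
  interpret E: quasi_normed "E n" \<kappa> for n by (rule E)
  have car: "(\<lambda>n. if n = k then v else 0) \<in> car (lr_sum q E)" for k
    unfolding lr_sum_simps using q
    by (intro CollectI conjI summable_finite[of "{k}"]) (auto simp: v E.zero_car)
  have "qnorm (lr_sum q E) (\<Sum>k\<in>F. smult (lr_sum q E) (s k) (\<lambda>n. if n = k then v else 0)) \<le>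
      real (card F) powr (1 / q)" if F: "finite F" "\<forall>k\<in>F. norm (s k) = 1" for F s
  proof -
    let ?f = "\<Sum>k\<in>F. smult (lr_sum q E) (s k) (\<lambda>n. if n = k then v else 0)"
    have f: "?f n = (if n \<in> F then smult (E n) (s n) v else 0)" for n
    proof -
      have "?f n = (\<Sum>k\<in>F. if k = n then smult (E n) (s n) v else 0)"
        by (auto simp: sum_fun_apply lr_sum_simps intro!: sum.cong)
      then show ?thesis using F(1) by simp
    qed
    have "(\<Sum>n. qnorm (E n) (?f n) powr q) = (\<Sum>n\<in>F. qnorm (E n) (?f n) powr q)"
      using F by (intro suminf_finite) (auto simp: f)
    also have "\<dots> \<le> (\<Sum>n\<in>F. 1)"
      using F q v by (intro sum_mono) (auto simp: f E.qnorm_smult E.qnorm_nonneg powr_le1)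
    finally have "(\<Sum>n. qnorm (E n) (?f n) powr q) \<le> real (card F)" by simp
    moreover have "0 \<le> (\<Sum>n. qnorm (E n) (?f n) powr q)"
      using F by (intro suminf_nonneg summable_finite[of F]) (auto simp: f)
    ultimately show ?thesis
      unfolding lr_sum_simps(3) using q by (intro powr_mono2) auto
  qed
  moreover have "norm (V (f k)) \<le> qnorm (lr_sum q E) f" if "f \<in> car (lr_sum q E)" for f k
    using that V(3)[of "f k" k] qnorm_le_qnorm_lr_sum[OF that q E.qnorm_nonneg, of k]
    by (auto simp: lr_sum_simps)
  ultimately show ?thesis
    unfolding lq_units_def using car by (auto simp: lr_sum_simps(2) V)
qed

lemma lq_units_lp: "0 < q \<Longrightarrow> \<exists>u U. lq_units (lp q) q u U"
  unfolding lp_eq_lr_sum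
  using lq_units_lr_sum[of q "\<lambda>_. scalar_space" 1 1 "\<lambda>x. x"] quasi_normed_scalar_space
  by (auto simp: scalar_space_def)

lemma first_unit_lp:
  fixes f :: "nat \<Rightarrow> 'k::{real_normed_field,euclidean_space}"
  assumes "0 < p"
  shows "(\<lambda>j. if j = 0 then 1 else 0 :: 'k) \<in> car (lp p)" "qnorm (lp p) (\<lambda>j. if j = 0 then 1 else 0 :: 'k) = 1"
    and "f \<in> car (lp p) \<Longrightarrow> norm (f 0) \<le> qnorm (lp p) f"
proof -
  show "(\<lambda>j. if j = 0 then 1 else 0 :: 'k) \<in> car (lp p)"
    using assms unfolding lp_simps by (intro CollectI summable_finite[of "{0}"]) auto
  show "qnorm (lp p) (\<lambda>j. if j = 0 then 1 else 0 :: 'k) = 1"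
    using assms unfolding lp_simps by (subst suminf_finite[of "{0}"]) auto
  show "norm (f 0) \<le> qnorm (lp p) f" if "f \<in> car (lp p)"
    using qnorm_le_qnorm_lr_sum[of f p "\<lambda>_. scalar_space" 0] that assms
    unfolding lp_eq_lr_sum by (simp add: scalar_space_def)
qed

lemma lq_units_lr_of_ls:
  assumes "0 < p" "0 < q"
  shows "\<exists>u U. lq_units (lr_of_ls q p :: ('k::{real_normed_field,euclidean_space}, _) qnspace) q u U"
proof -
  obtain \<kappa> where \<kappa>: "quasi_normed (lp p :: ('k, _) qnspace) \<kappa>" using quasi_normed_lp assms by blast
  have "lq_units (lr_sum q (\<lambda>n. lp p :: ('k, _) qnspace)) q (\<lambda>k n. if n = k then (\<lambda>j. if j = 0 then 1 else 0) else 0)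
      (\<lambda>k f. f k 0)"
    using first_unit_lp[OF assms(1), where 'k = 'k] assms \<kappa>
    by (intro lq_units_lr_sum[where V = "\<lambda>f. f 0" and \<kappa> = \<kappa>]) (auto simp: lp_simps(2))
  then show ?thesis unfolding lr_of_ls_def by blast
qed

lemma lq_units_lq_sum_lp_dims:
  assumes "0 < p" "0 < q"
  shows "\<exists>u U. lq_units (lq_sum_lp_dims q p :: ('k::{real_normed_field,euclidean_space}, _) qnspace) q u U"
proof -
  obtain \<kappa> where \<kappa>: "quasi_normed (lp p :: ('k, _) qnspace) \<kappa>" using quasi_normed_lp assms by blast
  let ?v = "\<lambda>j. if j = 0 then 1 else 0 :: 'k"
  have v: "?v \<in> car (lp_dim p (Suc n))" for n by (simp add: lp_dim_simps)
  have "lq_units (lr_sum q (\<lambda>n. lp_dim p (Suc n) :: ('k, _) qnspace)) q (\<lambda>k n. if n = k then ?v else 0) (\<lambda>k f. f k 0)"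
    using first_unit_lp[OF assms(1), where 'k = 'k] assms quasi_normed_lp_dim[OF \<kappa>] v
    by (intro lq_units_lr_sum[where V = "\<lambda>f. f 0" and \<kappa> = \<kappa>])
      (auto simp: lp_dim_simps(2) simp flip: lp_dim_subspace(2) intro: lp_dim_subspace(1))
  then show ?thesis unfolding lq_sum_lp_dims_def by blast
qed

text \<open>\<open>J\<close> is an isometric embedding and \<open>P\<close> a left inverse that does
  not increase quasi-norms. Composition with \<open>P\<close> extends the functionals from the copy
  of \<open>F\<close> to all of \<open>E\<close>.\<close>

lemma lq_units_embed:
  assumes "lq_units F q u U"
    and J: "\<And>f. f \<in> car F \<Longrightarrow> J f \<in> car E" "\<And>f. f \<in> car F \<Longrightarrow> qnorm E (J f) = qnorm F f"
      "\<And>f g. J (f + g) = J f + J g" "\<And>c f. J (smult F c f) = smult E c (J f)"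
      "\<And>f g. P (f + g) = P f + P g" "\<And>c f. P (smult E c f) = smult F c (P f)"
      "\<And>f. f \<in> car E \<Longrightarrow> P f \<in> car F" "\<And>f. f \<in> car E \<Longrightarrow> qnorm F (P f) \<le> qnorm E f"
      "\<And>f. P (J f) = f"
    and F: "quasi_normed F \<kappa>"
  shows "lq_units E q (\<lambda>k. J (u k)) (\<lambda>k f. U k (P f))"
proof -
  interpret F: quasi_normed F \<kappa> by fact
  note u = lq_unitsD[OF assms(1)]
  have J0: "J 0 = 0" using J(3)[of 0 0] by simp
  have J_sum: "J (\<Sum>k\<in>A. f k) = (\<Sum>k\<in>A. J (f k))" for A and f :: "nat \<Rightarrow> _"
    by (induction A rule: infinite_finite_induct) (auto simp: J0 J(3))
  have "qnorm E (\<Sum>k\<in>A. smult E (s k) (J (u k))) \<le> real (card A) powr (1 / q)"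
    if "finite A" "\<forall>k\<in>A. norm (s k) = 1" for A s
  proof -
    have "(\<Sum>k\<in>A. smult E (s k) (J (u k))) = J (\<Sum>k\<in>A. smult F (s k) (u k))"
      by (simp add: J_sum J(4))
    also have "qnorm E \<dots> = qnorm F (\<Sum>k\<in>A. smult F (s k) (u k))"
      by (intro J(2) F.sum_car F.smult_car u)
    finally show ?thesis using u(2)[of A s] that by simp
  qed
  moreover have "norm (U k (P f)) \<le> qnorm E f" if "f \<in> car E" for k f
    using order_trans[OF u(5)[OF J(7)] J(8)] that by blast
  ultimately show ?thesis
    unfolding lq_units_def by (simp add: J u)
qed

lemma qnorm_lr_sum_single:
  assumes "quasi_normed F \<kappa>" "0 < r" "f \<in> car F"
  shows "(\<lambda>n. if n = 0 then f else 0) \<in> car (lr_sum r (\<lambda>_. F))"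
    "qnorm (lr_sum r (\<lambda>_. F)) (\<lambda>n. if n = 0 then f else 0) = qnorm F f"
proof -
  interpret F: quasi_normed F \<kappa> by fact
  show "(\<lambda>n. if n = 0 then f else 0) \<in> car (lr_sum r (\<lambda>_. F))"
    using assms(2,3) unfolding lr_sum_simps
    by (intro CollectI conjI summable_finite[of "{0}"]) (auto simp: F.zero_car)
  show "qnorm (lr_sum r (\<lambda>_. F)) (\<lambda>n. if n = 0 then f else 0) = qnorm F f"
    using assms(2,3) unfolding lr_sum_simps
    by (subst suminf_finite[of "{0}"]) (auto simp: powr_powr F.qnorm_nonneg)
qed

lemma lq_units_lr_of_ls_inner:
  assumes "0 < p" "0 < q"
  shows "\<exists>u U. lq_units (lr_of_ls p q :: ('k::{real_normed_field,euclidean_space}, _) qnspace) q u U"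
proof -
  obtain \<kappa> where \<kappa>: "quasi_normed (lp q :: ('k, _) qnspace) \<kappa>" using quasi_normed_lp assms by blast
  interpret quasi_normed "lp q :: ('k, _) qnspace" \<kappa> by fact
  obtain u U where u: "lq_units (lp q :: ('k, _) qnspace) q u U" using lq_units_lp assms by blast
  have "lq_units (lr_sum p (\<lambda>_. lp q :: ('k, _) qnspace)) q (\<lambda>k n. if n = 0 then u k else 0) (\<lambda>k f. U k (f 0))"
    using u by (rule lq_units_embed[where P = "\<lambda>f. f 0" and J = "\<lambda>f n. if n = 0 then f else 0"])
      (use qnorm_lr_sum_single[OF \<kappa> assms(1)] \<kappa> qnorm_le_qnorm_lr_sum[OF _ assms(1) qnorm_nonneg]
        in \<open>auto simp: lr_sum_simps(1,2) fun_eq_iff\<close>)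
  then show ?thesis unfolding lr_of_ls_def by blast
qed

lemma lq_units_lp_plus_lq:
  assumes "0 < p" "0 < q"
  shows "\<exists>u U. lq_units (lp_plus_lq p q :: ('k::{real_normed_field,euclidean_space}, _) qnspace) q u U"
proof -
  obtain \<kappa> where \<kappa>: "quasi_normed (lp q :: ('k, _) qnspace) \<kappa>" using quasi_normed_lp assms by blast
  obtain \<kappa>' where \<kappa>': "quasi_normed (lp p :: ('k, _) qnspace) \<kappa>'" using quasi_normed_lp assms by blast
  interpret quasi_normed "lp q :: ('k, _) qnspace" \<kappa> by fact
  interpret p: quasi_normed "lp p :: ('k, _) qnspace" \<kappa>' by fact
  obtain u U where u: "lq_units (lp q :: ('k, _) qnspace) q u U" using lq_units_lp assms by blast
  have "lq_units (direct_sum (lp p :: ('k, _) qnspace) (lp q)) q (\<lambda>k. (0, u k)) (\<lambda>k f. U k (snd f))"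
    using u by (rule lq_units_embed[where P = "\<lambda>f. snd f" and J = "\<lambda>f. (0, f)"])
      (use \<kappa> p.zero_car p.qnorm_nonneg in \<open>auto simp: direct_sum_simps\<close>)
  then show ?thesis unfolding lp_plus_lq_def by blast
qed

subsection \<open>Sums of disjointly supported vectors\<close>

text \<open>For \<open>z\<close> equal to \<open>x\<close> or \<open>y\<close> one has
  \<open>z powr \<theta> \<le> z * (x + y) powr (\<theta> - 1)\<close>, as the exponent
  \<open>\<theta> - 1\<close> is nonnegative; the two bounds add up.\<close>

lemma powr_superadditive:
  fixes x y \<theta> :: real
  assumes "0 \<le> x" "0 \<le> y" "1 \<le> \<theta>"
  shows "x powr \<theta> + y powr \<theta> \<le> (x + y) powr \<theta>"
proof (cases "x + y = 0")
  case False
  then have pos: "0 < x + y" using assms by simp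
  have "z powr \<theta> \<le> z * (x + y) powr (\<theta> - 1)" if "0 \<le> z" "z \<le> x + y" for z
  proof (cases "z = 0")
    case False
    then have "z powr \<theta> = z * z powr (\<theta> - 1)" using that by (simp add: powr_mult_base)
    also have "\<dots> \<le> z * (x + y) powr (\<theta> - 1)"
      using that assms by (intro mult_left_mono powr_mono2) auto
    finally show ?thesis .
  qed simp
  from add_mono[OF this[of x] this[of y]] assms
  have "x powr \<theta> + y powr \<theta> \<le> (x + y) * (x + y) powr (\<theta> - 1)"
    by (simp add: distrib_right)
  also have "\<dots> = (x + y) powr \<theta>" using pos by (simp add: powr_mult_base)
  finally show ?thesis .
next
  case True
  then have "x = 0" "y = 0" using assms by linarith+
  then show ?thesis by simp
qed

text \<open>For disjointly supported \<open>b\<^sub>k\<close> in \<open>\<ell>\<^sub>r(\<ell>\<^sub>s)\<close> let \<open>w k n\<close> be the \<open>s\<close>-th power of the norm of row \<open>n\<close>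
  of \<open>b\<^sub>k\<close> and \<open>\<theta> = r / s\<close>; then \<open>\<Phi> F\<close> is the \<open>r\<close>-th power of the norm of \<open>\<Sum>\<^bsub>k\<in>F\<^esub> b\<^sub>k\<close>.\<close>

locale disjoint_rows =
  fixes w :: "nat \<Rightarrow> nat \<Rightarrow> real" and \<theta> a B :: real
  assumes \<theta>: "0 < \<theta>" and a: "0 < a"
    and w_nonneg: "0 \<le> w k n"
    and w_support: "\<exists>L. \<forall>n\<ge>L. w k n = 0"
    and w_lower: "a \<le> (\<Sum>n. w k n powr \<theta>)"
    and w_upper: "(\<Sum>n. w k n powr \<theta>) \<le> B"
begin

definition \<Phi> :: "nat set \<Rightarrow> real" where
  "\<Phi> F = (\<Sum>n. (\<Sum>k\<in>F. w k n) powr \<theta>)"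

lemma obtain_support:
  assumes "finite F"
  obtains L where "M \<le> L" "\<forall>k\<in>F. \<forall>n\<ge>L. w k n = 0"
proof -
  obtain L where L: "\<And>k n. L k \<le> n \<Longrightarrow> w k n = 0"
    using w_support by metis
  have "L k \<le> M + sum L F" if "k \<in> F" for k
    using member_le_sum[OF that, of L] assms by simp
  then show thesis
    using that[of "M + sum L F"] L by (meson le_add1 order_trans)
qed

lemma \<Phi>_eq:
  assumes "\<forall>k\<in>F. \<forall>n\<ge>L. w k n = 0"
  shows "\<Phi> F = (\<Sum>n<L. (\<Sum>k\<in>F. w k n) powr \<theta>)"
  unfolding \<Phi>_def using assms by (intro suminf_finite) auto

lemma \<Phi>_single:
  assumes "\<And>n. L \<le> n \<Longrightarrow> w k n = 0"
  shows "a \<le> (\<Sum>n<L. w k n powr \<theta>)" "(\<Sum>n<L. w k n powr \<theta>) \<le> B"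
proof -
  have "(\<Sum>n. w k n powr \<theta>) = (\<Sum>n<L. w k n powr \<theta>)"
    using assms by (intro suminf_finite) auto
  then show "a \<le> (\<Sum>n<L. w k n powr \<theta>)" "(\<Sum>n<L. w k n powr \<theta>) \<le> B"
    using w_lower[of k] w_upper[of k] by auto
qed

lemma \<Phi>_empty [simp]: "\<Phi> {} = 0"
  unfolding \<Phi>_def by simp

text \<open>The situation of \<open>\<ell>\<^sub>q(\<ell>\<^sub>p)\<close>. A single row in which
  the blocks do not tend to 0 already produces \<open>m powr \<theta>\<close>. If every row tends to
  0, members can be added one by one so that \<open>\<Phi>\<close> grows each time by an amount
  between \<open>a\<close> and \<open>B + 1\<close>.\<close>

lemma dichotomy_ge_1:
  assumes \<theta>1: "1 \<le> \<theta>"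
  shows "(\<exists>\<epsilon>>0. \<forall>m. \<exists>F. finite F \<and> card F = m \<and> \<epsilon> * real m powr \<theta> \<le> \<Phi> F) \<or>
    (\<exists>A>0. \<exists>K. \<forall>m. \<exists>F. finite F \<and> card F = m \<and> A * real m \<le> \<Phi> F \<and> \<Phi> F \<le> K * real m)"
proof (cases "\<forall>n. (\<lambda>k. w k n) \<longlonglongrightarrow> 0")
  case False
  then obtain n where "\<not> (\<lambda>k. w k n) \<longlonglongrightarrow> 0" by blast
  then obtain \<epsilon> where \<epsilon>: "0 < \<epsilon>" "\<not> (\<forall>\<^sub>F k in sequentially. w k n < \<epsilon>)"
    unfolding tendsto_iff using w_nonneg by auto
  then have inf: "infinite {k. \<epsilon> \<le> w k n}"
    unfolding eventually_cofinite cofinite_eq_sequentially[symmetric] by (simp add: not_less)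
  have "\<exists>F. finite F \<and> card F = m \<and> \<epsilon> powr \<theta> * real m powr \<theta> \<le> \<Phi> F" for m
  proof -
    obtain F where F: "finite F" "card F = m" "F \<subseteq> {k. \<epsilon> \<le> w k n}"
      using infinite_arbitrarily_large[OF inf] by blast
    obtain L where L: "Suc n \<le> L" "\<forall>k\<in>F. \<forall>n\<ge>L. w k n = 0"
      using obtain_support[OF F(1)] by metis
    have "\<epsilon> * real m \<le> (\<Sum>k\<in>F. w k n)"
      using sum_bounded_below[of F \<epsilon> "\<lambda>k. w k n"] F by (auto simp: mult.commute)
    then have "(\<epsilon> * real m) powr \<theta> \<le> (\<Sum>k\<in>F. w k n) powr \<theta>"
      using \<epsilon> \<theta> by (intro powr_mono2) auto
    also have "\<dots> \<le> \<Phi> F"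
      unfolding \<Phi>_eq[OF L(2)] using L(1) by (intro member_le_sum) auto
    finally show ?thesis using F \<epsilon> by (auto simp: powr_mult)
  qed
  then show ?thesis using \<epsilon>(1) by (metis powr_gt_zero less_irrefl)
next
  case True
  have "\<exists>F. finite F \<and> card F = m \<and> a * real m \<le> \<Phi> F \<and> \<Phi> F \<le> (B + 1) * real m" for m
  proof (induction m)
    case 0
    then show ?case by (intro exI[of _ "{}"]) simp
  next
    case (Suc m)
    then obtain F where F: "finite F" "card F = m" "a * real m \<le> \<Phi> F" "\<Phi> F \<le> (B + 1) * real m"
      by blast
    let ?W = "\<lambda>n. \<Sum>k\<in>F. w k n"
    have W: "0 \<le> ?W n" for n by (simp add: sum_nonneg w_nonneg)
    obtain L where L: "\<forall>k\<in>F. \<forall>n\<ge>L. w k n = 0"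
      using obtain_support[OF F(1)] by metis
    \<comment> \<open>On the finitely many rows met by \<open>F\<close> a late \<open>k\<close>
      raises \<open>\<Phi>\<close> by less than 1; on all other rows only \<open>w k\<close>
      contributes, at most \<open>B\<close>.\<close>
    have "(\<lambda>k. \<Sum>n<L. (?W n + w k n) powr \<theta>) \<longlonglongrightarrow> (\<Sum>n<L. (?W n + 0) powr \<theta>)"
      using True \<theta> W w_nonneg
      by (intro tendsto_sum tendsto_powr' tendsto_add tendsto_const) auto
    then have "(\<lambda>k. \<Sum>n<L. (?W n + w k n) powr \<theta>) \<longlonglongrightarrow> \<Phi> F"
      unfolding \<Phi>_eq[OF L] by simp
    then have "\<forall>\<^sub>F k in sequentially. (\<Sum>n<L. (?W n + w k n) powr \<theta>) < \<Phi> F + 1"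
      by (rule order_tendstoD(2)) simp
    moreover have "\<forall>\<^sub>F k in sequentially. k \<notin> F"
      using F(1) by (metis eventually_sequentiallyI finite_nat_set_iff_bounded not_less)
    ultimately have "\<forall>\<^sub>F k in sequentially. (\<Sum>n<L. (?W n + w k n) powr \<theta>) < \<Phi> F + 1 \<and> k \<notin> F"
      by eventually_elim auto
    then obtain k where k: "(\<Sum>n<L. (?W n + w k n) powr \<theta>) < \<Phi> F + 1" "k \<notin> F"
      by (auto simp: eventually_sequentially)
    obtain L' where L': "L \<le> L'" "\<forall>j\<in>insert k F. \<forall>n\<ge>L'. w j n = 0"
      using obtain_support[of "insert k F"] F(1) by (metis finite_insert)
    have "\<Phi> (insert k F) = (\<Sum>n<L'. (w k n + ?W n) powr \<theta>)"
      unfolding \<Phi>_eq[OF L'(2)] using F(1) k(2) by simp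
    then have eq: "\<Phi> (insert k F) = (\<Sum>n<L'. (?W n + w k n) powr \<theta>)"
      by (simp add: add.commute)
    \<comment> \<open>By superadditivity, an overlap with the old rows can only increase
      \<open>\<Phi>\<close>, so the new member counts in full from below.\<close>
    have "\<Phi> F + a \<le> (\<Sum>n<L'. ?W n powr \<theta>) + (\<Sum>n<L'. w k n powr \<theta>)"
      using \<Phi>_single(1)[of L' k] L'(2) by (simp add: \<Phi>_eq[of F L'])
    also have "\<dots> \<le> (\<Sum>n<L'. (?W n + w k n) powr \<theta>)"
      unfolding sum.distrib[symmetric]
      using W w_nonneg \<theta>1 by (intro sum_mono powr_superadditive) auto
    finally have lower: "\<Phi> F + a \<le> \<Phi> (insert k F)" unfolding eq .
    have split: "{..<L'} = {..<L} \<union> {L..<L'}" using L'(1) by auto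
    have "\<Phi> (insert k F) = (\<Sum>n<L. (?W n + w k n) powr \<theta>) + (\<Sum>n=L..<L'. (?W n + w k n) powr \<theta>)"
      unfolding eq split by (intro sum.union_disjoint) auto
    also have "(\<Sum>n=L..<L'. (?W n + w k n) powr \<theta>) = (\<Sum>n=L..<L'. w k n powr \<theta>)"
      using L by (intro sum.cong) auto
    also have "\<dots> \<le> (\<Sum>n<L'. w k n powr \<theta>)"
      by (intro sum_mono2) auto
    also have "\<dots> \<le> B" using L'(2) by (intro \<Phi>_single(2)) auto
    finally have "\<Phi> (insert k F) \<le> \<Phi> F + 1 + B" using k(1) by simp
    then show ?case
      using F k(2) lower by (intro exI[of _ "insert k F"]) (auto simp: algebra_simps)
  qed
  then show ?thesis using a by blast
qed

text \<open>The situation of \<open>\<ell>\<^sub>p(\<ell>\<^sub>q)\<close>. If a fixed mass is found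
  in arbitrarily distant rows, each such member adds \<open>\<epsilon>\<close>. Otherwise the tails
  are uniformly small, the profiles \<open>w k n powr \<theta>\<close> are relatively compact in
  \<open>\<ell>\<^sub>1\<close>, and any number of them can be chosen nearly equal;
  \<open>\<Phi>\<close> then behaves as for \<open>m\<close> copies of one profile.\<close>

lemma dichotomy_le_1:
  shows "(\<exists>\<epsilon>>0. \<forall>m. \<exists>F. finite F \<and> card F = m \<and> \<epsilon> * real m \<le> \<Phi> F) \<or>
    (\<exists>A>0. \<exists>K. \<forall>m. \<exists>F. finite F \<and> card F = m \<and>
      A * real m powr \<theta> \<le> \<Phi> F \<and> \<Phi> F \<le> K * real m powr \<theta>)"
proof (cases "\<exists>\<epsilon>>0. \<forall>N. \<exists>k L. \<epsilon> \<le> (\<Sum>n=N..<L. w k n powr \<theta>)")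
  case True
  then obtain \<epsilon> where \<epsilon>: "0 < \<epsilon>" "\<And>N. \<exists>k L. \<epsilon> \<le> (\<Sum>n=N..<L. w k n powr \<theta>)" by blast
  have "\<exists>F. finite F \<and> card F = m \<and> \<epsilon> * real m \<le> \<Phi> F" for m
  proof (induction m)
    case 0
    then show ?case by (intro exI[of _ "{}"]) simp
  next
    case (Suc m)
    then obtain F where F: "finite F" "card F = m" "\<epsilon> * real m \<le> \<Phi> F"
      by blast
    let ?W = "\<lambda>n. \<Sum>k\<in>F. w k n"
    obtain L where L: "\<forall>k\<in>F. \<forall>n\<ge>L. w k n = 0"
      using obtain_support[OF F(1)] by metis
    \<comment> \<open>Beyond \<open>L\<close> the members of \<open>F\<close> vanish, so the mass
      found there is pure gain and \<open>k\<close> is automatically new.\<close>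
    obtain k M where k: "\<epsilon> \<le> (\<Sum>n=L..<M. w k n powr \<theta>)" using \<epsilon>(2) by blast
    have "k \<notin> F"
    proof
      assume "k \<in> F"
      then have "(\<Sum>n=L..<M. w k n powr \<theta>) = 0" using L by (intro sum.neutral) auto
      then show False using k \<epsilon>(1) by simp
    qed
    obtain L' where L': "L + M \<le> L'" "\<forall>j\<in>insert k F. \<forall>n\<ge>L'. w j n = 0"
      using obtain_support[of "insert k F"] F(1) by (metis finite_insert)
    have split: "{..<L'} = {..<L} \<union> {L..<L'}" using L'(1) by auto
    have "\<Phi> F + \<epsilon> \<le> (\<Sum>n<L. ?W n powr \<theta>) + (\<Sum>n=L..<M. w k n powr \<theta>)"
      unfolding \<Phi>_eq[OF L] using k by simp
    also have "\<dots> \<le> (\<Sum>n<L. (w k n + ?W n) powr \<theta>) + (\<Sum>n=L..<L'. w k n powr \<theta>)"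
      using L'(1) w_nonneg \<theta>
      by (intro add_mono sum_mono powr_mono2 sum_mono2) (auto simp: sum_nonneg)
    also have "(\<Sum>n=L..<L'. w k n powr \<theta>) = (\<Sum>n=L..<L'. (w k n + ?W n) powr \<theta>)"
      using L by (intro sum.cong) auto
    also have "(\<Sum>n<L. (w k n + ?W n) powr \<theta>) + \<dots> = (\<Sum>n<L'. (w k n + ?W n) powr \<theta>)"
      unfolding split by (intro sum.union_disjoint[symmetric]) auto
    also have "\<dots> = \<Phi> (insert k F)"
      unfolding \<Phi>_eq[OF L'(2)] using F(1) \<open>k \<notin> F\<close> by simp
    finally show ?case
      using F \<open>k \<notin> F\<close> by (intro exI[of _ "insert k F"]) (auto simp: algebra_simps)
  qed
  then show ?thesis using \<epsilon>(1) by blast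
next
  case False
  let ?h = "\<lambda>k n. w k n powr \<theta>"
  have tail: "\<exists>N. \<forall>k L. (\<Sum>n=N..<L. ?h k n) < \<epsilon>" if "0 < \<epsilon>" for \<epsilon>
    using False that by (metis not_less)
  have h_le: "?h k n \<le> B" for k n
  proof -
    obtain L where L: "Suc n \<le> L" "\<forall>j\<in>{k}. \<forall>n\<ge>L. w j n = 0"
      using obtain_support[of "{k}" "Suc n"] by blast
    have "?h k n \<le> (\<Sum>n<L. ?h k n)" using L(1) by (intro member_le_sum) auto
    also have "\<dots> \<le> B" using L(2) by (intro \<Phi>_single(2)) auto
    finally show ?thesis .
  qed
  \<comment> \<open>A diagonal argument gives convergence in each row; combined with the uniform
    tail bound, the profiles are Cauchy in \<open>\<ell>\<^sub>1\<close>.\<close>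
  obtain \<rho> where \<rho>: "strict_mono (\<rho> :: nat \<Rightarrow> nat)" "\<And>n. \<exists>l. (\<lambda>k. ?h (\<rho> k) n) \<longlonglongrightarrow> l"
    using function_convergent_subsequence[of "UNIV :: nat set" ?h B] h_le by auto
  \<comment> \<open>Budget for the total deviation from the common profile: \<open>a / 2\<close>
    leaves half of the lower bound, and 1 raises the upper bound to \<open>B + 1\<close>.\<close>
  define e where "e = min 1 (a / 2)"
  have e: "0 < e" "e \<le> 1" "e \<le> a / 2" using a by (auto simp: e_def)
  have "\<exists>F. finite F \<and> card F = m \<and> a / 2 * real m powr \<theta> \<le> \<Phi> F \<and> \<Phi> F \<le> (B + 1) * real m powr \<theta>"
    for m
  proof (cases "m = 0")
    case True
    then show ?thesis by (intro exI[of _ "{}"]) simp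
  next
    case False
    \<comment> \<open>Each of the \<open>m\<close> profiles may deviate by
      \<open>4 * \<epsilon>\<close>: half of it on the first \<open>N\<close> rows, half from the
      tails of the two profiles compared.\<close>
    define \<epsilon> where "\<epsilon> = e / (4 * real m)"
    have \<epsilon>: "0 < \<epsilon>" using e False by (simp add: \<epsilon>_def)
    obtain N where N: "\<And>k L. (\<Sum>n=N..<L. ?h k n) < \<epsilon>" using tail[OF \<epsilon>] by blast
    \<comment> \<open>\<open>Suc N\<close> keeps \<open>\<delta>\<close> positive also for
      \<open>N = 0\<close>.\<close>
    define \<delta> where "\<delta> = 2 * \<epsilon> / real (Suc N)"
    have \<delta>: "0 < \<delta>" using \<epsilon> by (simp add: \<delta>_def)
    have "\<exists>J. \<forall>i\<ge>J. \<forall>j\<ge>J. \<bar>?h (\<rho> i) n - ?h (\<rho> j) n\<bar> < \<delta>" for n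
    proof -
      have "Cauchy (\<lambda>k. ?h (\<rho> k) n)" using \<rho>(2) LIMSEQ_imp_Cauchy by blast
      then show ?thesis using \<delta> unfolding Cauchy_def dist_real_def by blast
    qed
    then obtain Jn where Jn: "\<And>n i j. Jn n \<le> i \<Longrightarrow> Jn n \<le> j \<Longrightarrow> \<bar>?h (\<rho> i) n - ?h (\<rho> j) n\<bar> < \<delta>"
      by metis
    define J where "J = (\<Sum>n<N. Jn n)"
    have J: "\<bar>?h (\<rho> i) n - ?h (\<rho> j) n\<bar> < \<delta>" if "n < N" "J \<le> i" "J \<le> j" for n i j
      using member_le_sum[of n "{..<N}" Jn] that by (intro Jn) (auto simp: J_def)
    let ?F = "\<rho> ` {J..<J + m}"
    have F: "finite ?F" "card ?F = m"
      using strict_mono_imp_inj_on[OF \<rho>(1)] by (auto simp: card_image inj_on_subset)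
    let ?g = "?h (\<rho> J)"
    \<comment> \<open>Summing the deviations gives one majorant for all \<open>k\<close> at once:
      every \<open>w k n\<close> is at most \<open>(?g n + D n) powr (1 / \<theta>)\<close>, and at
      least \<open>(?g n - D n) powr (1 / \<theta>)\<close> when this difference is
      nonnegative.\<close>
    define D where "D n = (\<Sum>k\<in>?F. \<bar>?h k n - ?g n\<bar>)" for n
    have D: "\<bar>?h k n - ?g n\<bar> \<le> D n" if "k \<in> ?F" for k n
      unfolding D_def using that F(1) by (intro member_le_sum) auto
    obtain L where L: "N \<le> L" "\<forall>k\<in>?F. \<forall>n\<ge>L. w k n = 0"
      using obtain_support[OF F(1)] by metis
    have D_sum: "(\<Sum>n<L. D n) \<le> e"
    proof -
      have "(\<Sum>n<L. \<bar>?h k n - ?g n\<bar>) \<le> 4 * \<epsilon>" if k: "k \<in> ?F" for k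
      proof -
        have split: "{..<L} = {..<N} \<union> {N..<L}" using L(1) by auto
        have "(\<Sum>n<L. \<bar>?h k n - ?g n\<bar>) = (\<Sum>n<N. \<bar>?h k n - ?g n\<bar>) + (\<Sum>n=N..<L. \<bar>?h k n - ?g n\<bar>)"
          unfolding split by (intro sum.union_disjoint) auto
        also have "(\<Sum>n<N. \<bar>?h k n - ?g n\<bar>) \<le> (\<Sum>n<N. \<delta>)"
          using k J by (intro sum_mono) (auto intro: less_imp_le)
        also have "\<dots> \<le> 2 * \<epsilon>" using \<epsilon> by (simp add: \<delta>_def field_simps)
        also have "(\<Sum>n=N..<L. \<bar>?h k n - ?g n\<bar>) \<le> (\<Sum>n=N..<L. ?h k n + ?g n)"
          by (intro sum_mono) (auto simp: abs_le_iff)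
        also have "\<dots> \<le> 2 * \<epsilon>"
          using N[of k L] N[of "\<rho> J" L] by (simp add: sum.distrib)
        finally show ?thesis by simp
      qed
      then have "(\<Sum>k\<in>?F. \<Sum>n<L. \<bar>?h k n - ?g n\<bar>) \<le> real (card ?F) * (4 * \<epsilon>)"
        by (rule sum_bounded_above)
      also have "\<dots> = e" using F(2) False by (simp add: \<epsilon>_def)
      finally show ?thesis unfolding D_def by (subst sum.swap)
    qed
    have w_eq: "w k n = ?h k n powr (1 / \<theta>)" for k n
      using \<theta> w_nonneg by (simp add: powr_powr)
    have W: "0 \<le> (\<Sum>k\<in>?F. w k n)" for n by (intro sum_nonneg w_nonneg)
    have D0: "0 \<le> D n" for n unfolding D_def by (intro sum_nonneg) auto
    have up: "(\<Sum>k\<in>?F. w k n) powr \<theta> \<le> real m powr \<theta> * (?g n + D n)" for n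
    proof -
      have "w k n \<le> (?g n + D n) powr (1 / \<theta>)" if "k \<in> ?F" for k
        using D[OF that, of n] \<theta> by (subst w_eq[of k n], intro powr_mono2) auto
      then have "(\<Sum>k\<in>?F. w k n) \<le> real m * (?g n + D n) powr (1 / \<theta>)"
        using sum_bounded_above[of ?F "\<lambda>k. w k n"] F(2) by metis
      then have "(\<Sum>k\<in>?F. w k n) powr \<theta> \<le> (real m * (?g n + D n) powr (1 / \<theta>)) powr \<theta>"
        using \<theta> W by (intro powr_mono2) auto
      also have "\<dots> = real m powr \<theta> * (?g n + D n)"
        using \<theta> D0[of n] by (simp add: powr_mult powr_powr)
      finally show ?thesis .
    qed
    have low: "real m powr \<theta> * (?g n - D n) \<le> (\<Sum>k\<in>?F. w k n) powr \<theta>" for n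
    proof (cases "0 \<le> ?g n - D n")
      case True
      have "(?g n - D n) powr (1 / \<theta>) \<le> w k n" if "k \<in> ?F" for k
        using D[OF that, of n] \<theta> True by (subst w_eq[of k n], intro powr_mono2) auto
      then have "real m * (?g n - D n) powr (1 / \<theta>) \<le> (\<Sum>k\<in>?F. w k n)"
        using sum_bounded_below[of ?F _ "\<lambda>k. w k n"] F(2) by metis
      then have "(real m * (?g n - D n) powr (1 / \<theta>)) powr \<theta> \<le> (\<Sum>k\<in>?F. w k n) powr \<theta>"
        using \<theta> by (intro powr_mono2) auto
      then show ?thesis using \<theta> True by (simp add: powr_mult powr_powr)
    next
      case False
      then have "real m powr \<theta> * (?g n - D n) \<le> 0" by (simp add: mult_nonneg_nonpos)
      then show ?thesis by (meson order_trans powr_ge_zero)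
    qed
    have h0: "a \<le> sum ?g {..<L}" "sum ?g {..<L} \<le> B"
      using False L(2) by (intro \<Phi>_single; auto)+
    have "\<Phi> ?F \<le> (\<Sum>n<L. real m powr \<theta> * (?g n + D n))"
      unfolding \<Phi>_eq[OF L(2)] by (intro sum_mono up)
    also have "\<dots> = real m powr \<theta> * (sum ?g {..<L} + sum D {..<L})"
      by (simp add: sum_distrib_left[symmetric] sum.distrib)
    also have "\<dots> \<le> real m powr \<theta> * (B + 1)"
      using h0 D_sum e by (intro mult_left_mono) auto
    finally have 1: "\<Phi> ?F \<le> (B + 1) * real m powr \<theta>" by (simp add: mult.commute)
    have "real m powr \<theta> * (a / 2) \<le> real m powr \<theta> * (sum ?g {..<L} - sum D {..<L})"
      using h0 D_sum e by (intro mult_left_mono) auto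
    also have "\<dots> = (\<Sum>n<L. real m powr \<theta> * (?g n - D n))"
      by (simp add: sum_distrib_left[symmetric] sum_subtractf)
    also have "\<dots> \<le> \<Phi> ?F"
      unfolding \<Phi>_eq[OF L(2)] by (intro sum_mono low)
    finally show ?thesis using 1 F by (intro exI[of _ ?F]) (auto simp: mult.commute)
  qed
  then show ?thesis using a by (metis half_gt_zero)
qed

end

subsection \<open>Gliding hump in mixed-norm spaces\<close>

definition row_sum :: "real \<Rightarrow> (nat \<Rightarrow> nat \<Rightarrow> 'k::real_normed_vector) \<Rightarrow> nat \<Rightarrow> real" where
  "row_sum s f n = (\<Sum>i. norm (f n i) powr s)"

text \<open>Cutting along \<open>max n i\<close> bounds both indices: the support is a finite square
  shell. Shells of successive intervals share no entry but may share rows.\<close>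

definition block :: "nat \<Rightarrow> nat \<Rightarrow> (nat \<Rightarrow> nat \<Rightarrow> 'k::zero) \<Rightarrow> nat \<Rightarrow> nat \<Rightarrow> 'k" where
  "block N M f = (\<lambda>n i. if N \<le> max n i \<and> max n i < M then f n i else 0)"

lemma row_sum_nonneg:
  assumes "summable (\<lambda>i. norm (f n i) powr s)"
  shows "0 \<le> row_sum s f n"
  unfolding row_sum_def using assms by (intro suminf_nonneg) auto

lemma row_sum_finite:
  assumes "\<And>i. L \<le> i \<Longrightarrow> f n i = 0"
  shows "row_sum s f n = (\<Sum>i<L. norm (f n i) powr s)"
  unfolding row_sum_def using assms by (intro suminf_finite) auto

context
  fixes r s :: real
  assumes r: "0 < r" and s: "0 < s"
begin

lemma lr_of_ls_simps:
  "f \<in> car (lr_of_ls r s) \<longleftrightarrow>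
     (\<forall>n. summable (\<lambda>i. norm (f n i) powr s)) \<and> summable (\<lambda>n. row_sum s f n powr (r / s))"
  "smult (lr_of_ls r s) c f = (\<lambda>n i. c * f n i)"
  "qnorm (lr_of_ls r s) f = (\<Sum>n. row_sum s f n powr (r / s)) powr (1 / r)"
  unfolding lr_of_ls_def lr_sum_simps lp_simps row_sum_def
  using s by (simp_all add: powr_powr)

lemma finite_support_car:
  assumes "\<And>n i. L \<le> n \<or> L \<le> i \<Longrightarrow> f n i = 0"
  shows "f \<in> car (lr_of_ls r s)"
    and "qnorm (lr_of_ls r s) f = (\<Sum>n<L. (\<Sum>i<L. norm (f n i) powr s) powr (r / s)) powr (1 / r)"
proof -
  have row: "row_sum s f n = (\<Sum>i<L. norm (f n i) powr s)" for n
    using assms by (intro row_sum_finite) auto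
  show "f \<in> car (lr_of_ls r s)"
    unfolding lr_of_ls_simps
  proof
    show "\<forall>n. summable (\<lambda>i. norm (f n i) powr s)"
      by (rule allI, rule summable_finite[of "{..<L}"]) (auto simp: assms)
    show "summable (\<lambda>n. row_sum s f n powr (r / s))"
      by (rule summable_finite[of "{..<L}"]) (auto simp: row assms)
  qed
  show "qnorm (lr_of_ls r s) f = (\<Sum>n<L. (\<Sum>i<L. norm (f n i) powr s) powr (r / s)) powr (1 / r)"
    unfolding lr_of_ls_simps by (subst suminf_finite[of "{..<L}"]) (auto simp: row assms)
qed

lemma block_car: "block N M f \<in> car (lr_of_ls r s)"
  by (intro finite_support_car[of M]) (auto simp: block_def)

lemma head_tendsto_0:
  assumes "\<And>n i. (\<lambda>k. f k n i) \<longlonglongrightarrow> 0"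
  shows "(\<lambda>k. qnorm (lr_of_ls r s) (block 0 N (f k))) \<longlonglongrightarrow> 0"
proof -
  have "qnorm (lr_of_ls r s) (block 0 N (f k)) =
      (\<Sum>n<N. (\<Sum>i<N. norm (f k n i) powr s) powr (r / s)) powr (1 / r)" for k
    by (subst finite_support_car(2)[of N]) (auto simp: block_def)
  moreover have "(\<lambda>k. (\<Sum>n<N. (\<Sum>i<N. norm (f k n i) powr s) powr (r / s)) powr (1 / r)) \<longlonglongrightarrow> 0"
  proof -
    have "(\<lambda>k. norm (f k n i) powr s) \<longlonglongrightarrow> 0" for n i
      by (rule tendsto_zero_powrI[OF tendsto_norm_zero[OF assms] tendsto_const]) (use s in auto)
    then have "(\<lambda>k. \<Sum>i<N. norm (f k n i) powr s) \<longlonglongrightarrow> 0" for n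
      by (intro tendsto_null_sum)
    then have "(\<lambda>k. (\<Sum>i<N. norm (f k n i) powr s) powr (r / s)) \<longlonglongrightarrow> 0" for n
      by (rule tendsto_zero_powrI[OF _ tendsto_const]) (use r s in \<open>auto simp: sum_nonneg\<close>)
    then have "(\<lambda>k. \<Sum>n<N. (\<Sum>i<N. norm (f k n i) powr s) powr (r / s)) \<longlonglongrightarrow> 0"
      by (intro tendsto_null_sum)
    then show ?thesis
      by (rule tendsto_zero_powrI[OF _ tendsto_const]) (use r in \<open>auto simp: sum_nonneg\<close>)
  qed
  ultimately show ?thesis by simp
qed

text \<open>Dominated convergence for series, used twice: inside each row with the entries of
  \<open>f\<close> as majorants, then over the rows with the row sums of \<open>f\<close>.\<close>

lemma tail_tendsto_0:
  assumes f: "f \<in> car (lr_of_ls r s)"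
  shows "(\<lambda>N. qnorm (lr_of_ls r s) (f - block 0 N f)) \<longlonglongrightarrow> 0"
proof -
  have summ: "summable (\<lambda>i. norm (f n i) powr s)" for n
    using f unfolding lr_of_ls_simps by blast
  have summ_rows: "summable (\<lambda>n. row_sum s f n powr (r / s))"
    using f unfolding lr_of_ls_simps by blast
  let ?g = "\<lambda>N. f - block 0 N f"
  have g_le: "norm (?g N n i) powr s \<le> norm (f n i) powr s" for N n i
    by (auto simp: block_def)
  have g_summ: "summable (\<lambda>i. norm (?g N n i) powr s)" for N n
    using g_le by (intro summable_comparison_test'[OF summ[of n], of 0]) auto
  have row_le: "row_sum s (?g N) n \<le> row_sum s f n" for N n
    unfolding row_sum_def by (intro suminf_le g_le g_summ summ)
  have row_nonneg: "0 \<le> row_sum s (?g N) n" for N n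
    by (rule row_sum_nonneg, rule g_summ)
  have row: "(\<lambda>N. row_sum s (?g N) n) \<longlonglongrightarrow> 0" for n
  proof -
    have "(\<lambda>N. \<Sum>i. norm (?g N n i) powr s) \<longlonglongrightarrow> (\<Sum>i. 0::real)"
    proof (rule tannerys_theorem[THEN conjunct2, THEN conjunct2])
      show "(\<lambda>N. norm (?g N n i) powr s) \<longlonglongrightarrow> 0" for i
        by (rule tendsto_eventually, rule eventually_sequentiallyI[of "Suc (max n i)"])
          (auto simp: block_def)
      show "\<forall>\<^sub>F (i, N) in at_top \<times>\<^sub>F sequentially. norm (norm (?g N n i) powr s) \<le> norm (f n i) powr s"
        using g_le by (intro always_eventually) auto
    qed (auto intro: summ)
    then show ?thesis unfolding row_sum_def by simp
  qed
  have "(\<lambda>N. \<Sum>n. row_sum s (?g N) n powr (r / s)) \<longlonglongrightarrow> (\<Sum>n. 0::real)"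
  proof (rule tannerys_theorem[THEN conjunct2, THEN conjunct2])
    show "(\<lambda>N. row_sum s (?g N) n powr (r / s)) \<longlonglongrightarrow> 0" for n
      by (rule tendsto_zero_powrI[OF row tendsto_const]) (use r s row_nonneg in auto)
    show "\<forall>\<^sub>F (n, N) in at_top \<times>\<^sub>F sequentially.
        norm (row_sum s (?g N) n powr (r / s)) \<le> row_sum s f n powr (r / s)"
      using r s row_le row_nonneg
      by (intro always_eventually) (auto intro!: powr_mono2)
    show "summable (\<lambda>n. row_sum s f n powr (r / s))" by (rule summ_rows)
  qed auto
  then have lim: "(\<lambda>N. \<Sum>n. row_sum s (?g N) n powr (r / s)) \<longlonglongrightarrow> 0" by simp
  have "0 \<le> (\<Sum>n. row_sum s (?g N) n powr (r / s))" for N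
  proof (rule suminf_nonneg)
    have "row_sum s (?g N) n powr (r / s) \<le> row_sum s f n powr (r / s)" for n
      using r s by (intro powr_mono2 row_le row_nonneg) auto
    then show "summable (\<lambda>n. row_sum s (?g N) n powr (r / s))"
      by (intro summable_comparison_test'[OF summ_rows, of 0]) auto
  qed auto
  then show ?thesis
    unfolding lr_of_ls_simps by (intro tendsto_zero_powrI[OF lim tendsto_const]) (use r in auto)
qed

lemma norm_coordinate_le:
  assumes f: "f \<in> car (lr_of_ls r s)"
  shows "norm (f n i) \<le> qnorm (lr_of_ls r s) f"
proof -
  have f': "f \<in> car (lr_sum r (\<lambda>n. lp s))" using f unfolding lr_of_ls_def .
  then have "f n \<in> car (lr_sum s (\<lambda>_. scalar_space))"
    by (simp add: lr_sum_simps lp_eq_lr_sum)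
  then have "norm (f n i) \<le> qnorm (lp s) (f n)"
    using qnorm_le_qnorm_lr_sum[of "f n" s "\<lambda>_. scalar_space" i] s
    by (simp add: lp_eq_lr_sum scalar_space_def)
  also have "\<dots> \<le> qnorm (lr_sum r (\<lambda>n. lp s)) f"
    using f' r by (intro qnorm_le_qnorm_lr_sum) (auto simp: lp_simps)
  finally show ?thesis unfolding lr_of_ls_def .
qed

text \<open>The gliding hump. Beyond the end \<open>N\<close> of the last block, entrywise
  convergence to 0 makes the square below \<open>N\<close> negligible for a late member, and the
  part of that member beyond a suitable \<open>M\<close> is negligible as well.\<close>

lemma block_subsequence:
  assumes f: "\<And>k. f k \<in> car (lr_of_ls r s)" and lim: "\<And>n i. (\<lambda>k. f k n i) \<longlonglongrightarrow> 0"
    and \<eta>: "\<And>j. 0 < (\<eta> j :: real)"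
  obtains \<tau> N where "strict_mono (\<tau> :: nat \<Rightarrow> nat)" "mono (N :: nat \<Rightarrow> nat)"
    "\<And>j. qnorm (lr_of_ls r s) (f (\<tau> j) - block (N j) (N (Suc j)) (f (\<tau> j))) \<le> \<eta> j"
proof -
  let ?E = "lr_of_ls r s :: ('a, _) qnspace"
  obtain \<kappa> where "quasi_normed ?E \<kappa>" using quasi_normed_lr_of_ls r s by blast
  then interpret quasi_normed ?E \<kappa> .
  have step: "\<exists>t>t0. \<exists>M\<ge>N. qnorm ?E (f t - block N M (f t)) \<le> e" if e: "0 < e" for t0 N e
  proof -
    let ?e = "e / (2 * \<kappa>)"
    have e': "0 < ?e" using e kappa by simp
    have "\<forall>\<^sub>F t in sequentially. qnorm ?E (block 0 N (f t)) < ?e"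
      using head_tendsto_0[OF lim] e' by (rule order_tendstoD(2))
    then have "\<forall>\<^sub>F t in sequentially. qnorm ?E (block 0 N (f t)) < ?e \<and> t0 < t"
      using eventually_gt_at_top by (rule eventually_conj)
    then obtain t where t: "qnorm ?E (block 0 N (f t)) < ?e" "t0 < t"
      by (auto simp: eventually_sequentially)
    have "\<forall>\<^sub>F M in sequentially. qnorm ?E (f t - block 0 M (f t)) < ?e"
      using tail_tendsto_0[OF f] e' by (rule order_tendstoD(2))
    then have "\<forall>\<^sub>F M in sequentially. qnorm ?E (f t - block 0 M (f t)) < ?e \<and> N \<le> M"
      using eventually_ge_at_top by (rule eventually_conj)
    then obtain M where M: "qnorm ?E (f t - block 0 M (f t)) < ?e" "N \<le> M"
      by (auto simp: eventually_sequentially)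
    have "f t - block N M (f t) = (f t - block 0 M (f t)) + block 0 N (f t)"
      using M(2) by (auto simp: fun_eq_iff block_def)
    then have "qnorm ?E (f t - block N M (f t)) \<le>
        \<kappa> * (qnorm ?E (f t - block 0 M (f t)) + qnorm ?E (block 0 N (f t)))"
      using qnorm_add[OF diff_car[OF f block_car] block_car] by (simp only:)
    also have "\<dots> \<le> \<kappa> * (?e + ?e)"
      using kappa t(1) M(1) by (intro mult_left_mono add_mono) auto
    also have "\<dots> = e" using kappa by (simp add: field_simps)
    finally show ?thesis using t(2) M(2) by blast
  qed
  \<comment> \<open>A state of the recursion holds the index of a member and the two ends of its
    block; \<open>Q\<close> lets the next block start where the last one stops.\<close>
  define P where "P j x \<longleftrightarrow> (case x of (t, N, M) \<Rightarrow>
    N \<le> M \<and> qnorm ?E (f t - block N M (f t)) \<le> \<eta> j)" for j :: nat and x :: "nat \<times> nat \<times> nat"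
  define Q where "Q x x' \<longleftrightarrow> fst x < fst x' \<and> fst (snd x') = snd (snd x)"
    for x x' :: "nat \<times> nat \<times> nat"
  have "\<exists>x. \<forall>j. P j (x j) \<and> Q (x j) (x (Suc j))"
  proof (rule dependent_nat_choice)
    show "\<exists>x. P 0 x" using step[OF \<eta>[of 0], of 0 0] unfolding P_def by force
    show "\<exists>x'. P (Suc j) x' \<and> Q x x'" if "P j x" for x j
      using step[OF \<eta>[of "Suc j"], of "fst x" "snd (snd x)"] unfolding P_def Q_def by force
  qed
  then obtain x where x: "\<And>j. P j (x j)" "\<And>j. Q (x j) (x (Suc j))" by blast
  show thesis
  proof (rule that[of "\<lambda>j. fst (x j)" "\<lambda>j. fst (snd (x j))"])
    show "strict_mono (\<lambda>j. fst (x j))"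
      using x(2) unfolding strict_mono_Suc_iff Q_def by blast
    show "mono (\<lambda>j. fst (snd (x j)))"
      unfolding mono_iff_le_Suc
    proof
      show "fst (snd (x j)) \<le> fst (snd (x (Suc j)))" for j
        using x(1)[of j] x(2)[of j] unfolding P_def Q_def by (simp add: case_prod_beta)
    qed
    show "qnorm ?E (f (fst (x j)) - block (fst (snd (x j))) (fst (snd (x (Suc j)))) (f (fst (x j)))) \<le> \<eta> j" for j
      using x(1)[of j] x(2)[of j] unfolding P_def Q_def by (simp add: case_prod_beta)
  qed
qed

text \<open>At every entry at most one block is nonzero, so s-th powers of moduli add. This is what
  lets \<open>\<Phi>\<close> compute the quasi-norm of a sum of blocks.\<close>

lemma sum_disjoint_blocks:
  fixes b :: "nat \<Rightarrow> nat \<Rightarrow> nat \<Rightarrow> 'k::{real_normed_field,euclidean_space}"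
  assumes N: "mono N" and b: "\<And>j. b j = block (N j) (N (Suc j)) (g j)" and F: "finite F"
  shows "row_sum s (\<Sum>j\<in>F. b j) n = (\<Sum>j\<in>F. row_sum s (b j) n)"
proof -
  have disj: "b j n i = 0 \<or> b k n i = 0" if "j \<noteq> k" for j k i
  proof -
    have *: "b j n i = 0 \<or> b k n i = 0" if "j < k" for j k
      using monoD[OF N, of "Suc j" k] that unfolding b by (auto simp: block_def)
    show ?thesis using *[of j k] *[of k j] that by linarith
  qed
  have pt: "norm ((\<Sum>j\<in>F. b j) n i) powr s = (\<Sum>j\<in>F. norm (b j n i) powr s)" for i
  proof (cases "\<exists>j\<in>F. b j n i \<noteq> 0")
    case True
    then obtain j where j: "j \<in> F" "b j n i \<noteq> 0" by blast
    then have 0: "b k n i = 0" if "k \<noteq> j" for k using disj[of j k i] that by auto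
    have "(\<Sum>k\<in>F. b k n i) = b j n i"
      using j F 0 by (subst sum.remove[of F j]) (auto intro!: sum.neutral)
    moreover have "(\<Sum>k\<in>F. norm (b k n i) powr s) = norm (b j n i) powr s"
      using j F 0 by (subst sum.remove[of F j]) (auto intro!: sum.neutral)
    ultimately show ?thesis by (simp add: sum_fun_apply)
  next
    case False
    then show ?thesis by (simp add: sum_fun_apply)
  qed
  have summ: "summable (\<lambda>i. norm (b j n i) powr s)" for j
    unfolding b by (rule lr_of_ls_simps(1)[THEN iffD1, OF block_car, THEN conjunct1, THEN spec])
  show ?thesis
    unfolding row_sum_def pt by (rule suminf_sum[OF summ])
qed

lemma disjoint_rows_blocks:
  fixes b :: "nat \<Rightarrow> nat \<Rightarrow> nat \<Rightarrow> 'k::{real_normed_field,euclidean_space}"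
  assumes b: "\<And>j. b j = block (N j) (N (Suc j)) (g j)"
    and c: "0 < c" "\<And>j. c \<le> qnorm (lr_of_ls r s) (b j)" "\<And>j. qnorm (lr_of_ls r s) (b j) \<le> M"
  shows "disjoint_rows (\<lambda>j. row_sum s (b j)) (r / s) (c powr r) (M powr r)"
proof
  show "0 < r / s" "0 < c powr r" using r s c by auto
  show "0 \<le> row_sum s (b k) n" for k n
    unfolding b
    by (rule row_sum_nonneg, rule lr_of_ls_simps(1)[THEN iffD1, OF block_car, THEN conjunct1, THEN spec])
  show "\<exists>L. \<forall>n\<ge>L. row_sum s (b k) n = 0" for k
    by (rule exI[of _ "N (Suc k)"]) (auto simp: row_sum_def b block_def)
  have "summable (\<lambda>n. row_sum s (b k) n powr (r / s))" for k
    using block_car[of "N k" "N (Suc k)" "g k"] unfolding b lr_of_ls_simps by blast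
  then have "0 \<le> (\<Sum>n. row_sum s (b k) n powr (r / s))" for k
    by (intro suminf_nonneg) auto
  then have eq: "(\<Sum>n. row_sum s (b k) n powr (r / s)) = qnorm (lr_of_ls r s) (b k) powr r" for k
    unfolding lr_of_ls_simps using r by (simp add: powr_powr)
  show "c powr r \<le> (\<Sum>n. row_sum s (b k) n powr (r / s))" for k
    unfolding eq using c r by (intro powr_mono2) auto
  have "0 \<le> qnorm (lr_of_ls r s) (b k)" for k unfolding lr_of_ls_simps by simp
  then show "(\<Sum>n. row_sum s (b k) n powr (r / s)) \<le> M powr r" for k
    unfolding eq using c(3) r by (intro powr_mono2) auto
qed

text \<open>The errors beat the factors of \<open>qnorm_sum_le\<close>: the products are at most
  \<open>\<delta> * (1 / 2) ^ Suc j\<close>, so the total stays below \<open>\<delta>\<close> for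
  every finite \<open>F\<close>, whatever its size.\<close>

lemma sum_near_sum:
  fixes f b :: "nat \<Rightarrow> nat \<Rightarrow> nat \<Rightarrow> 'k::{real_normed_field,euclidean_space}"
  assumes \<kappa>: "quasi_normed (lr_of_ls r s :: ('k, _) qnspace) \<kappa>"
    and car: "\<And>j. f j \<in> car (lr_of_ls r s)" "\<And>j. b j \<in> car (lr_of_ls r s)"
    and le: "\<And>j. qnorm (lr_of_ls r s) (f j - b j) \<le> \<delta> / (2 * \<kappa>) ^ Suc j" and \<delta>: "0 \<le> \<delta>"
    and F: "finite F"
  shows "qnorm (lr_of_ls r s) (sum f F - sum b F) \<le> \<delta>"
proof -
  interpret quasi_normed "lr_of_ls r s :: ('k, _) qnspace" \<kappa> by fact
  obtain m where m: "F \<subseteq> {..<m}" using F finite_nat_set_iff_bounded by auto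
  \<comment> \<open>Padding with zeros turns \<open>F\<close> into an initial segment, as
    \<open>qnorm_sum_le\<close> requires.\<close>
  let ?e = "\<lambda>j. if j \<in> F then f j - b j else 0"
  have "sum f F - sum b F = (\<Sum>j\<in>{..<m} \<inter> F. f j - b j)"
    using m by (simp add: sum_subtractf Int_absorb1)
  also have "\<dots> = (\<Sum>j<m. ?e j)" by (rule sum.inter_restrict) simp
  finally have "qnorm (lr_of_ls r s) (sum f F - sum b F) = qnorm (lr_of_ls r s) (\<Sum>j<m. ?e j)"
    by (rule arg_cong)
  also have "\<dots> \<le> (\<Sum>j<m. \<kappa> ^ Suc j * qnorm (lr_of_ls r s) (?e j))"
    using car by (intro qnorm_sum_le) (auto simp: diff_car zero_car)
  also have "\<dots> \<le> (\<Sum>j<m. \<delta> * (1 / 2) ^ Suc j)"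
  proof (rule sum_mono)
    fix j
    have "qnorm (lr_of_ls r s) (?e j) \<le> \<delta> / (2 * \<kappa>) ^ Suc j"
      using le[of j] \<delta> kappa by simp
    then have "\<kappa> ^ Suc j * qnorm (lr_of_ls r s) (?e j) \<le> \<kappa> ^ Suc j * (\<delta> / (2 * \<kappa>) ^ Suc j)"
      using kappa by (intro mult_left_mono) auto
    also have "\<dots> = \<delta> * (1 / 2) ^ Suc j"
      using kappa unfolding power_mult_distrib by (simp add: power_one_over)
    finally show "\<kappa> ^ Suc j * qnorm (lr_of_ls r s) (?e j) \<le> \<delta> * (1 / 2) ^ Suc j" .
  qed
  also have "\<dots> = \<delta> * (\<Sum>j<m. (1 / 2) ^ Suc j)" by (rule sum_distrib_left[symmetric])
  also have "(\<Sum>j<m. (1 / 2) ^ Suc j) = 1 - (1 / 2 :: real) ^ m"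
    by (induction m) auto
  also have "\<delta> * \<dots> \<le> \<delta>" using \<delta> by (simp add: right_diff_distrib)
  finally show ?thesis .
qed

text \<open>Entries are dominated by the quasi-norm and there are countably many, so a diagonal
  argument applies. The limit need not be 0; taking differences will cancel it.\<close>

lemma obtain_convergent_subsequence:
  fixes x :: "nat \<Rightarrow> nat \<Rightarrow> nat \<Rightarrow> 'k::{real_normed_field,euclidean_space}"
  assumes "\<And>k. x k \<in> car (lr_of_ls r s)" "\<And>k. qnorm (lr_of_ls r s) (x k) \<le> M"
  obtains \<rho> where "strict_mono (\<rho> :: nat \<Rightarrow> nat)" "\<And>n i. \<exists>l. (\<lambda>k. x (\<rho> k) n i) \<longlonglongrightarrow> l"
proof -
  have "norm (x k n i) \<le> M" for k n i
    using norm_coordinate_le[OF assms(1)] assms(2) order_trans by blast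
  then have bound: "norm (x k (fst z) (snd z)) \<le> M" for k z by blast
  obtain \<rho> where \<rho>: "strict_mono (\<rho> :: nat \<Rightarrow> nat)"
      "\<And>z. z \<in> UNIV \<Longrightarrow> \<exists>l. (\<lambda>k. x (\<rho> k) (fst z) (snd z)) \<longlonglongrightarrow> l"
    using function_convergent_subsequence[of "UNIV :: (nat \<times> nat) set" "\<lambda>k z. x k (fst z) (snd z)" M]
      bound by blast
  have "\<exists>l. (\<lambda>k. x (\<rho> k) n i) \<longlonglongrightarrow> l" for n i
    using \<rho>(2)[of "(n, i)"] by simp
  with \<rho>(1) show thesis by (rule that)
qed

text \<open>The hypothesis is the numerical alternative for disjoint blocks; its exponents are
  \<open>r / p\<close> and \<open>r / q\<close> because \<open>\<Phi>\<close> is the r-th power of a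
  quasi-norm. The rest is the perturbation from differences to blocks.\<close>

lemma difference_dichotomy_lr_of_ls:
  assumes growth: "\<And>w a B. disjoint_rows w (r / s) a B \<Longrightarrow>
      (\<exists>A>0. \<forall>m. \<exists>F. finite F \<and> card F = m \<and>
          A * real m powr (r / p) \<le> disjoint_rows.\<Phi> w (r / s) F) \<or>
      (\<exists>A>0. \<exists>K. \<forall>m. \<exists>F. finite F \<and> card F = m \<and>
          A * real m powr (r / q) \<le> disjoint_rows.\<Phi> w (r / s) F \<and>
          disjoint_rows.\<Phi> w (r / s) F \<le> K * real m powr (r / q))"
  shows "difference_dichotomy (lr_of_ls r s :: ('k::{real_normed_field,euclidean_space}, _) qnspace) p q"
proof -
  let ?E = "lr_of_ls r s :: ('k, _) qnspace"
  obtain \<kappa> where \<kappa>: "quasi_normed ?E \<kappa>" using quasi_normed_lr_of_ls r s by blast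
  interpret quasi_normed ?E \<kappa> by (fact \<kappa>)
  show ?thesis
    unfolding difference_dichotomy_def
  proof (intro allI impI)
    fix x :: "nat \<Rightarrow> nat \<Rightarrow> nat \<Rightarrow> 'k" and c M :: real
    assume x: "\<forall>n. x n \<in> car ?E \<and> qnorm ?E (x n) \<le> M" and c: "0 < c"
      and sep: "\<forall>i j. i \<noteq> j \<longrightarrow> c \<le> qnorm ?E (x i - x j)"
    obtain \<rho> where \<rho>: "strict_mono (\<rho> :: nat \<Rightarrow> nat)"
      "\<And>n i. \<exists>l. (\<lambda>k. x (\<rho> k) n i) \<longlonglongrightarrow> l"
      using obtain_convergent_subsequence[of x M] x by blast
    define d where "d k = x (\<rho> (2 * k)) - x (\<rho> (2 * k + 1))" for k
    have d: "d k \<in> car ?E" for k unfolding d_def using x by (intro diff_car) auto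
    have d_lim: "(\<lambda>k. d k n i) \<longlonglongrightarrow> 0" for n i
    proof -
      obtain l where l: "(\<lambda>k. x (\<rho> k) n i) \<longlonglongrightarrow> l" using \<rho>(2) by blast
      have "(\<lambda>k. x (\<rho> (2 * k)) n i - x (\<rho> (2 * k + 1)) n i) \<longlonglongrightarrow> l - l"
        by (intro tendsto_diff; rule LIMSEQ_subseq_LIMSEQ[OF l, unfolded comp_def])
          (auto simp: strict_mono_def)
      then show ?thesis by (simp add: d_def)
    qed
    have d_lower: "c \<le> qnorm ?E (d k)" for k
      using sep strict_mono_eq[OF \<rho>(1)] unfolding d_def by simp
    have d_upper: "qnorm ?E (d k) \<le> 2 * \<kappa> * M" for k
    proof -
      have "qnorm ?E (d k) \<le> \<kappa> * (qnorm ?E (x (\<rho> (2 * k))) + qnorm ?E (x (\<rho> (2 * k + 1))))"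
        unfolding d_def using x by (intro qnorm_diff) auto
      also have "\<dots> \<le> \<kappa> * (M + M)" using x kappa by (intro mult_left_mono add_mono) auto
      finally show ?thesis by simp
    qed
    \<comment> \<open>The blocks inherit half of the separation:
      \<open>c \<le> \<kappa> * (qnorm ?E (b j) + \<delta>)\<close> then leaves
      \<open>c / (2 * \<kappa>)\<close> for \<open>b j\<close>.\<close>
    define \<delta> where "\<delta> = c / (2 * \<kappa>)"
    have \<delta>: "0 < \<delta>" using c kappa by (simp add: \<delta>_def)
    have \<eta>: "0 < \<delta> / (2 * \<kappa>) ^ Suc j" for j using \<delta> kappa by simp
    obtain \<tau> N where \<tau>: "strict_mono \<tau>" "mono N"
      "\<And>j. qnorm ?E (d (\<tau> j) - block (N j) (N (Suc j)) (d (\<tau> j))) \<le> \<delta> / (2 * \<kappa>) ^ Suc j"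
      by (rule block_subsequence[where \<eta> = "\<lambda>j. \<delta> / (2 * \<kappa>) ^ Suc j", OF d d_lim \<eta>]) (rule that)
    define b where "b j = block (N j) (N (Suc j)) (d (\<tau> j))" for j
    have b: "b j \<in> car ?E" for j unfolding b_def by (rule block_car)
    have near: "qnorm ?E ((\<Sum>j\<in>F. d (\<tau> j)) - sum b F) \<le> \<delta>" if "finite F" for F
      using that \<delta> \<tau>(3) by (intro sum_near_sum[OF \<kappa> d b]) (auto simp: b_def)
    have lower: "qnorm ?E (sum b F) / \<kappa> \<le> qnorm ?E (\<Sum>j\<in>F. d (\<tau> j)) + \<delta>" if F: "finite F" for F
    proof -
      have "qnorm ?E (sum b F) \<le> \<kappa> * (qnorm ?E (\<Sum>j\<in>F. d (\<tau> j)) + qnorm ?E ((\<Sum>j\<in>F. d (\<tau> j)) - sum b F))"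
        using qnorm_diff[of "\<Sum>j\<in>F. d (\<tau> j)" "(\<Sum>j\<in>F. d (\<tau> j)) - sum b F"] d b
        by (simp add: sum_car diff_car)
      also have "\<dots> \<le> \<kappa> * (qnorm ?E (\<Sum>j\<in>F. d (\<tau> j)) + \<delta>)"
        using kappa near[OF F] by (intro mult_left_mono add_left_mono) auto
      finally show ?thesis using kappa by (simp add: field_simps)
    qed
    have upper: "qnorm ?E (\<Sum>j\<in>F. d (\<tau> j)) \<le> \<kappa> * (qnorm ?E (sum b F) + \<delta>)" if F: "finite F" for F
      using qnorm_triangle_lower[OF sum_car sum_car, of F "\<lambda>j. d (\<tau> j)" F b] d b near[OF F] kappa
      by (smt (verit) mult_left_mono)
    have b_lower: "c / (2 * \<kappa>) \<le> qnorm ?E (b j)" for j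
    proof -
      have "c \<le> \<kappa> * (qnorm ?E (b j) + \<delta>)"
        using upper[of "{j}"] d_lower[of "\<tau> j"] by simp
      then show ?thesis using kappa unfolding \<delta>_def by (simp add: field_simps)
    qed
    have b_upper: "qnorm ?E (b j) \<le> \<kappa> * (2 * \<kappa> * M + \<delta>)" for j
    proof -
      have "qnorm ?E (b j) \<le> \<kappa> * (qnorm ?E (d (\<tau> j)) + \<delta>)"
        using lower[of "{j}"] kappa by (simp add: field_simps)
      also have "\<dots> \<le> \<kappa> * (2 * \<kappa> * M + \<delta>)"
        using d_upper kappa by (intro mult_left_mono add_right_mono) auto
      finally show ?thesis .
    qed
    let ?w = "\<lambda>j. row_sum s (b j)"
    have rows: "disjoint_rows ?w (r / s) ((c / (2 * \<kappa>)) powr r) ((\<kappa> * (2 * \<kappa> * M + \<delta>)) powr r)"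
      using c kappa b_lower b_upper by (intro disjoint_rows_blocks[where b = b and N = N and g = "\<lambda>j. d (\<tau> j)", OF b_def]) auto
    then interpret disjoint_rows ?w "r / s" "(c / (2 * \<kappa>)) powr r" "(\<kappa> * (2 * \<kappa> * M + \<delta>)) powr r" .
    have \<Phi>: "qnorm ?E (sum b F) = \<Phi> F powr (1 / r)" if "finite F" for F
      unfolding lr_of_ls_simps \<Phi>_def
      using sum_disjoint_blocks[where b = b and g = "\<lambda>j. d (\<tau> j)", OF \<tau>(2) b_def that] by (simp only:)
    have \<Phi>_nonneg: "0 \<le> \<Phi> F" if F: "finite F" for F
    proof -
      obtain L where "\<forall>k\<in>F. \<forall>n\<ge>L. ?w k n = 0" using obtain_support[OF F] by metis
      from \<Phi>_eq[OF this] show ?thesis by (simp add: sum_nonneg)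
    qed
    \<comment> \<open>The subsequence \<open>\<tau>\<close> selects whole pairs, so the k-th pair
      along \<open>\<sigma>\<close> has difference exactly \<open>d (\<tau> k)\<close>.\<close>
    define \<sigma> where "\<sigma> i = \<rho> (2 * \<tau> (i div 2) + i mod 2)" for i
    have \<sigma>: "inj \<sigma>"
    proof (rule injI)
      fix i j assume "\<sigma> i = \<sigma> j"
      then have "2 * \<tau> (i div 2) + i mod 2 = 2 * \<tau> (j div 2) + j mod 2"
        unfolding \<sigma>_def using strict_mono_eq[OF \<rho>(1)] by simp
      then have "\<tau> (i div 2) = \<tau> (j div 2) \<and> i mod 2 = j mod 2" by presburger
      then have "i div 2 = j div 2" "i mod 2 = j mod 2" using strict_mono_eq[OF \<tau>(1)] by auto
      then show "i = j" by (metis div_mult_mod_eq)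
    qed
    have pair: "pair_sum x \<sigma> F = (\<Sum>j\<in>F. d (\<tau> j))" for F
      unfolding pair_sum_def d_def \<sigma>_def by simp
    have powr_le: "A powr (1 / r) / \<kappa> * real m powr (1 / t) \<le> qnorm ?E (pair_sum x \<sigma> F) + \<kappa> * \<delta>"
      if "finite F" "0 < A" "A * real m powr (r / t) \<le> \<Phi> F" for F A m t
    proof -
      have "A powr (1 / r) * real m powr (1 / t) = (A * real m powr (r / t)) powr (1 / r)"
        using r that(2) by (simp add: powr_mult powr_powr)
      also have "\<dots> \<le> \<Phi> F powr (1 / r)"
        using r that by (intro powr_mono2) auto
      also have "\<dots> = qnorm ?E (sum b F)" using \<Phi>[OF that(1)] by simp
      finally have "A powr (1 / r) * real m powr (1 / t) / \<kappa> \<le> qnorm ?E (sum b F) / \<kappa>"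
        using kappa by (intro divide_right_mono) auto
      also have "\<dots> \<le> qnorm ?E (pair_sum x \<sigma> F) + \<delta>" unfolding pair by (rule lower[OF that(1)])
      also have "\<delta> \<le> \<kappa> * \<delta>" using kappa \<delta> by simp
      finally show ?thesis by simp
    qed
    have powr_ge: "qnorm ?E (pair_sum x \<sigma> F) \<le> \<kappa> * K powr (1 / r) * real m powr (1 / t) + \<kappa> * \<delta>"
      if "finite F" "0 \<le> K" "\<Phi> F \<le> K * real m powr (r / t)" for F K m t
    proof -
      have "qnorm ?E (sum b F) \<le> (K * real m powr (r / t)) powr (1 / r)"
        unfolding \<Phi>[OF that(1)] using r that \<Phi>_nonneg by (intro powr_mono2) auto
      also have "\<dots> = K powr (1 / r) * real m powr (1 / t)"
        using r that(2) by (simp add: powr_mult powr_powr)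
      finally have "\<kappa> * (qnorm ?E (sum b F) + \<delta>) \<le> \<kappa> * (K powr (1 / r) * real m powr (1 / t) + \<delta>)"
        using kappa by (intro mult_left_mono add_right_mono) auto
      with upper[OF that(1)] show ?thesis unfolding pair by (simp add: distrib_left mult.assoc)
    qed
    have pos: "0 < A powr (1 / r) / \<kappa>" if "0 < A" for A using that kappa by simp
    from growth[OF rows] show "\<exists>\<sigma>. inj \<sigma> \<and>
          ((\<exists>c>0. \<exists>D. \<forall>m. \<exists>F. finite F \<and> card F = m \<and>
              c * real m powr (1 / p) \<le> qnorm ?E (pair_sum x \<sigma> F) + D) \<or>
           (\<exists>c>0. \<exists>D K. \<forall>m. \<exists>F. finite F \<and> card F = m \<and>
              c * real m powr (1 / q) \<le> qnorm ?E (pair_sum x \<sigma> F) + D \<and>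
              qnorm ?E (pair_sum x \<sigma> F) \<le> K * real m powr (1 / q) + D))"
    proof (elim disjE exE conjE)
      fix A :: real
      assume A: "0 < A" "\<forall>m. \<exists>F. finite F \<and> card F = m \<and> A * real m powr (r / p) \<le> \<Phi> F"
      have "\<exists>F. finite F \<and> card F = m \<and>
          A powr (1 / r) / \<kappa> * real m powr (1 / p) \<le> qnorm ?E (pair_sum x \<sigma> F) + \<kappa> * \<delta>" for m
        using A powr_le by meson
      then show ?thesis using \<sigma> pos[OF A(1)] by blast
    next
      fix A K :: real
      assume A: "0 < A" "\<forall>m. \<exists>F. finite F \<and> card F = m \<and>
        A * real m powr (r / q) \<le> \<Phi> F \<and> \<Phi> F \<le> K * real m powr (r / q)"
      have K: "K * real m powr (r / q) \<le> \<bar>K\<bar> * real m powr (r / q)" for m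
        by (intro mult_right_mono) auto
      have "\<exists>F. finite F \<and> card F = m \<and>
          A powr (1 / r) / \<kappa> * real m powr (1 / q) \<le> qnorm ?E (pair_sum x \<sigma> F) + \<kappa> * \<delta> \<and>
          qnorm ?E (pair_sum x \<sigma> F) \<le> \<kappa> * \<bar>K\<bar> powr (1 / r) * real m powr (1 / q) + \<kappa> * \<delta>" for m
      proof -
        obtain F where F: "finite F" "card F = m" "A * real m powr (r / q) \<le> \<Phi> F"
          "\<Phi> F \<le> K * real m powr (r / q)" using A(2) by blast
        show ?thesis
          using F(1,2) powr_le[OF F(1) A(1) F(3)] powr_ge[OF F(1) abs_ge_zero order_trans[OF F(4) K]]
          by blast
      qed
      then show ?thesis using \<sigma> pos[OF A(1)] by blast
    qed
  qed
qed

end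

section \<open>The alternative in each of the four spaces\<close>

lemma difference_dichotomy_lp_of_lq:
  assumes p: "0 < p" "p < 1" and q: "1 < q"
  shows "difference_dichotomy (lr_of_ls p q :: ('k::{real_normed_field,euclidean_space}, _) qnspace) p q"
proof (rule difference_dichotomy_lr_of_ls)
  fix w a B assume "disjoint_rows w (p / q) a B"
  then interpret disjoint_rows w "p / q" a B .
  show "(\<exists>A>0. \<forall>m. \<exists>F. finite F \<and> card F = m \<and> A * real m powr (p / p) \<le> \<Phi> F) \<or>
      (\<exists>A>0. \<exists>K. \<forall>m. \<exists>F. finite F \<and> card F = m \<and>
          A * real m powr (p / q) \<le> \<Phi> F \<and> \<Phi> F \<le> K * real m powr (p / q))"
    using dichotomy_le_1 p by simp
qed (use p q in auto)

text \<open>Here \<open>\<Phi>\<close> is a q-th power, so additive growth means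
  \<open>m powr (1 / q)\<close> in quasi-norm and the growth \<open>m powr (q / p)\<close> of one
  row means \<open>m powr (1 / p)\<close>. In \<open>\<ell>\<^sub>p(\<ell>\<^sub>q)\<close> additive
  growth is the case of exponent \<open>1 / p\<close>.\<close>

lemma difference_dichotomy_lq_of_lp:
  assumes p: "0 < p" "p < 1" and q: "1 < q"
  shows "difference_dichotomy (lr_of_ls q p :: ('k::{real_normed_field,euclidean_space}, _) qnspace) p q"
proof (rule difference_dichotomy_lr_of_ls)
  fix w a B assume "disjoint_rows w (q / p) a B"
  then interpret disjoint_rows w "q / p" a B .
  show "(\<exists>A>0. \<forall>m. \<exists>F. finite F \<and> card F = m \<and> A * real m powr (q / p) \<le> \<Phi> F) \<or>
      (\<exists>A>0. \<exists>K. \<forall>m. \<exists>F. finite F \<and> card F = m \<and>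
          A * real m powr (q / q) \<le> \<Phi> F \<and> \<Phi> F \<le> K * real m powr (q / q))"
    using dichotomy_ge_1 p q by simp
qed (use p q in auto)

text \<open>Pair sums commute with the additive map \<open>J\<close>, so passing to an isomorphic
  copy changes only the constants.\<close>

lemma difference_dichotomy_embed:
  fixes E :: "('k::real_normed_field, 'v::ab_group_add) qnspace"
    and F :: "('k, 'w::ab_group_add) qnspace" and J :: "'v \<Rightarrow> 'w"
  assumes F: "difference_dichotomy F p q" and E: "quasi_normed E \<kappa>"
    and J: "\<And>f g. J (f - g) = J f - J g" "\<And>f. f \<in> car E \<Longrightarrow> J f \<in> car F"
      "\<And>f. f \<in> car E \<Longrightarrow> qnorm F (J f) \<le> a * qnorm E f"
      "\<And>f. f \<in> car E \<Longrightarrow> qnorm E f \<le> b * qnorm F (J f)"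
    and a: "0 < a" and b: "0 < b"
  shows "difference_dichotomy E p q"
  unfolding difference_dichotomy_def
proof (intro allI impI)
  interpret quasi_normed E \<kappa> by fact
  fix x :: "nat \<Rightarrow> 'v" and c M :: real
  assume x: "\<forall>n. x n \<in> car E \<and> qnorm E (x n) \<le> M" and c: "0 < c"
    and sep: "\<forall>i j. i \<noteq> j \<longrightarrow> c \<le> qnorm E (x i - x j)"
  have xc: "x n \<in> car E" for n using x by blast
  have J0: "J 0 = 0" using J(1)[of 0 0] by simp
  have J_add: "J (f + g) = J f + J g" for f g
    using J(1)[of "f + g" g] by (simp add: eq_diff_eq)
  have J_sum: "J (sum f A) = (\<Sum>i\<in>A. J (f i))" for f and A :: "nat set"
    by (induction A rule: infinite_finite_induct) (auto simp: J0 J_add)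
  have pair: "pair_sum (\<lambda>n. J (x n)) \<sigma> A = J (pair_sum x \<sigma> A)" for \<sigma> A
    unfolding pair_sum_def by (simp only: J_sum J(1))
  have pair_car: "pair_sum x \<sigma> A \<in> car E" for \<sigma> A
    unfolding pair_sum_def by (intro sum_car diff_car xc)
  have "qnorm F (J (x n)) \<le> a * M" for n
  proof -
    have "a * qnorm E (x n) \<le> a * M" using x a by (intro mult_left_mono) auto
    with J(3)[OF xc, of n] show ?thesis by linarith
  qed
  then have "\<forall>n. J (x n) \<in> car F \<and> qnorm F (J (x n)) \<le> a * M"
    using J(2)[OF xc] by blast
  moreover have "0 < c / b" using b c by simp
  moreover have "\<forall>i j. i \<noteq> j \<longrightarrow> c / b \<le> qnorm F (J (x i) - J (x j))"
  proof (intro allI impI)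
    fix i j :: nat assume "i \<noteq> j"
    then have "c \<le> b * qnorm F (J (x i - x j))"
      using sep J(4)[OF diff_car[OF xc xc]] order_trans by blast
    then show "c / b \<le> qnorm F (J (x i) - J (x j))"
      using b by (simp add: J(1) field_simps)
  qed
  ultimately have "\<exists>\<sigma>. inj \<sigma> \<and>
      ((\<exists>c>0. \<exists>D. \<forall>m. \<exists>A. finite A \<and> card A = m \<and>
          c * real m powr (1 / p) \<le> qnorm F (pair_sum (\<lambda>n. J (x n)) \<sigma> A) + D) \<or>
       (\<exists>c>0. \<exists>D K. \<forall>m. \<exists>A. finite A \<and> card A = m \<and>
          c * real m powr (1 / q) \<le> qnorm F (pair_sum (\<lambda>n. J (x n)) \<sigma> A) + D \<and>
          qnorm F (pair_sum (\<lambda>n. J (x n)) \<sigma> A) \<le> K * real m powr (1 / q) + D))"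
    (is "\<exists>\<sigma>. inj \<sigma> \<and> ?P \<sigma>")
    by (rule F[unfolded difference_dichotomy_def, THEN spec, THEN spec, THEN spec, THEN mp, THEN mp, THEN mp])
  then obtain \<sigma> where \<sigma>: "inj \<sigma>" and dis: "?P \<sigma>"
    by (elim exE conjE) (rule that)
  from dis show "\<exists>\<sigma>. inj \<sigma> \<and>
      ((\<exists>c>0. \<exists>D. \<forall>m. \<exists>A. finite A \<and> card A = m \<and>
          c * real m powr (1 / p) \<le> qnorm E (pair_sum x \<sigma> A) + D) \<or>
       (\<exists>c>0. \<exists>D K. \<forall>m. \<exists>A. finite A \<and> card A = m \<and>
          c * real m powr (1 / q) \<le> qnorm E (pair_sum x \<sigma> A) + D \<and>
          qnorm E (pair_sum x \<sigma> A) \<le> K * real m powr (1 / q) + D))"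
    unfolding pair
  proof (elim disjE exE conjE)
    fix c D :: real
    assume c: "0 < c" and est: "\<forall>m. \<exists>A. finite A \<and> card A = m \<and>
      c * real m powr (1 / p) \<le> qnorm F (J (pair_sum x \<sigma> A)) + D"
    have "\<exists>A. finite A \<and> card A = m \<and> c / a * real m powr (1 / p) \<le> qnorm E (pair_sum x \<sigma> A) + D / a" for m
    proof -
      obtain A where A: "finite A" "card A = m"
        "c * real m powr (1 / p) \<le> qnorm F (J (pair_sum x \<sigma> A)) + D"
        using est by blast
      have "c * real m powr (1 / p) \<le> a * qnorm E (pair_sum x \<sigma> A) + D"
        using A(3) J(3)[OF pair_car, of \<sigma> A] by linarith
      then show ?thesis using A a by (intro exI[of _ A]) (simp add: field_simps)
    qed
    moreover have "0 < c / a" using c a by simp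
    ultimately show ?thesis using \<sigma> by blast
  next
    fix c D K :: real
    assume c: "0 < c" and est: "\<forall>m. \<exists>A. finite A \<and> card A = m \<and>
      c * real m powr (1 / q) \<le> qnorm F (J (pair_sum x \<sigma> A)) + D \<and>
      qnorm F (J (pair_sum x \<sigma> A)) \<le> K * real m powr (1 / q) + D"
    \<comment> \<open>One additive constant has to serve both estimates: the lower one produces
      \<open>D / a\<close>, the upper one \<open>b * D\<close>.\<close>
    have "\<exists>A. finite A \<and> card A = m \<and>
        c / a * real m powr (1 / q) \<le> qnorm E (pair_sum x \<sigma> A) + max (D / a) (b * D) \<and>
        qnorm E (pair_sum x \<sigma> A) \<le> b * K * real m powr (1 / q) + max (D / a) (b * D)" for m
    proof -
      obtain A where A: "finite A" "card A = m"
        "c * real m powr (1 / q) \<le> qnorm F (J (pair_sum x \<sigma> A)) + D"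
        "qnorm F (J (pair_sum x \<sigma> A)) \<le> K * real m powr (1 / q) + D"
        using est by blast
      have "b * qnorm F (J (pair_sum x \<sigma> A)) \<le> b * (K * real m powr (1 / q) + D)"
        using A(4) b by (intro mult_left_mono) auto
      then have "qnorm E (pair_sum x \<sigma> A) \<le> b * K * real m powr (1 / q) + b * D"
        using J(4)[OF pair_car, of \<sigma> A] by (simp add: distrib_left mult.assoc)
      moreover have "c * real m powr (1 / q) \<le> a * qnorm E (pair_sum x \<sigma> A) + D"
        using A(3) J(3)[OF pair_car, of \<sigma> A] by linarith
      then have "c / a * real m powr (1 / q) \<le> qnorm E (pair_sum x \<sigma> A) + D / a"
        using a by (simp add: field_simps)
      ultimately show ?thesis
        using A(1,2) by (intro exI[of _ A]) (simp add: max_def)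
    qed
    moreover have "0 < c / a" using c a by simp
    ultimately show ?thesis using \<sigma> by blast
  qed
qed

lemma difference_dichotomy_lq_sum_lp_dims:
  assumes p: "0 < p" "p < 1" and q: "1 < q"
  shows "difference_dichotomy (lq_sum_lp_dims q p :: ('k::{real_normed_field,euclidean_space}, _) qnspace) p q"
proof -
  obtain \<kappa> where \<kappa>: "quasi_normed (lq_sum_lp_dims q p :: ('k, _) qnspace) \<kappa>"
    using quasi_normed_lq_sum_lp_dims[of p q] p q by auto
  show ?thesis
    by (rule difference_dichotomy_embed[OF difference_dichotomy_lq_of_lp[OF assms] \<kappa>,
          where J = "\<lambda>f. f" and a = 1 and b = 1])
      (auto simp: lq_sum_lp_dims_subspace)
qed

text \<open>The second summand becomes row \<open>0\<close>, the first one the column of the first entries of the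
  remaining rows.\<close>

definition embed_sum :: "(nat \<Rightarrow> 'k::zero) \<times> (nat \<Rightarrow> 'k) \<Rightarrow> nat \<Rightarrow> nat \<Rightarrow> 'k" where
  "embed_sum z = (\<lambda>n i. case n of 0 \<Rightarrow> snd z i | Suc k \<Rightarrow> if i = 0 then fst z k else 0)"

lemma embed_sum:
  fixes z :: "(nat \<Rightarrow> 'k::{real_normed_field,euclidean_space}) \<times> (nat \<Rightarrow> 'k)"
  assumes p: "0 < p" and q: "0 < q" and z: "z \<in> car (lp_plus_lq p q)"
  shows "embed_sum z \<in> car (lr_of_ls p q)"
    and "qnorm (lr_of_ls p q) (embed_sum z) =
      (qnorm (lp p) (fst z) powr p + qnorm (lp q) (snd z) powr p) powr (1 / p)"
proof -
  have zp: "summable (\<lambda>k. norm (fst z k) powr p)" and zq: "summable (\<lambda>i. norm (snd z i) powr q)"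
    using z by (auto simp: lp_plus_lq_def direct_sum_simps lp_simps)
  have row0: "embed_sum z 0 = snd z" by (simp add: embed_sum_def)
  have rowS: "embed_sum z (Suc k) \<in> car (lp q)" "qnorm (lp q) (embed_sum z (Suc k)) = norm (fst z k)" for k
  proof -
    show "embed_sum z (Suc k) \<in> car (lp q)"
      unfolding lp_simps embed_sum_def by (intro CollectI summable_finite[of "{0}"]) (use q in auto)
    have "(\<Sum>i. norm (embed_sum z (Suc k) i) powr q) = norm (fst z k) powr q"
      by (subst suminf_finite[of "{0}"]) (auto simp: embed_sum_def)
    then show "qnorm (lp q) (embed_sum z (Suc k)) = norm (fst z k)"
      using q by (simp add: lp_simps powr_powr)
  qed
  have row: "embed_sum z n \<in> car (lp q)" for n
    using rowS row0 zq by (cases n) (auto simp: lp_simps(1))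
  have summ: "summable (\<lambda>n. qnorm (lp q) (embed_sum z n) powr p)"
    using zp by (subst summable_Suc_iff[symmetric]) (simp add: rowS)
  show "embed_sum z \<in> car (lr_of_ls p q)"
    unfolding lr_of_ls_def lr_sum_simps using row summ by blast
  have "(\<Sum>n. qnorm (lp q) (embed_sum z n) powr p) =
      (\<Sum>k. norm (fst z k) powr p) + qnorm (lp q) (snd z) powr p"
    using suminf_split_head[OF summ] by (simp add: rowS row0)
  also have "(\<Sum>k. norm (fst z k) powr p) = qnorm (lp p) (fst z) powr p"
    using p zp by (simp add: lp_simps powr_powr suminf_nonneg)
  finally show "qnorm (lr_of_ls p q) (embed_sum z) =
      (qnorm (lp p) (fst z) powr p + qnorm (lp q) (snd z) powr p) powr (1 / p)"
    unfolding lr_of_ls_def lr_sum_simps by simp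
qed

text \<open>\<open>embed_sum\<close> replaces the sum of the two norms by their
  \<open>\<ell>\<^sub>p\<close> sum. The latter is at least the larger of the two, whence the
  constant 2, and at most \<open>2 powr (1 / p)\<close> times their sum.\<close>

lemma difference_dichotomy_lp_plus_lq:
  assumes p: "0 < p" "p < 1" and q: "1 < q"
  shows "difference_dichotomy (lp_plus_lq p q :: ('k::{real_normed_field,euclidean_space}, _) qnspace) p q"
proof -
  obtain \<kappa> where \<kappa>: "quasi_normed (lp_plus_lq p q :: ('k, _) qnspace) \<kappa>"
    using quasi_normed_lp_plus_lq[of p q] p q by auto
  have q0: "0 < q" using q by simp
  show ?thesis
  proof (rule difference_dichotomy_embed[OF difference_dichotomy_lp_of_lq[OF assms] \<kappa>])
    show "embed_sum (f - g) = embed_sum f - embed_sum g" for f g :: "(nat \<Rightarrow> 'k) \<times> (nat \<Rightarrow> 'k)"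
      by (auto simp: embed_sum_def fun_eq_iff split: nat.split)
    fix f :: "(nat \<Rightarrow> 'k) \<times> (nat \<Rightarrow> 'k)"
    assume f: "f \<in> car (lp_plus_lq p q)"
    show "embed_sum f \<in> car (lr_of_ls p q)" by (rule embed_sum[OF p(1) q0 f])
    let ?a = "qnorm (lp p) (fst f)" and ?b = "qnorm (lp q) (snd f)"
    have ab: "0 \<le> ?a" "0 \<le> ?b" by (simp_all add: lp_simps)
    have eq: "qnorm (lp_plus_lq p q) f = ?a + ?b" by (simp add: lp_plus_lq_def direct_sum_simps)
    note J = embed_sum(2)[OF p(1) q0 f]
    have "?a = (?a powr p) powr (1 / p)" "?b = (?b powr p) powr (1 / p)"
      using p ab by (simp_all add: powr_powr)
    moreover have "(?a powr p) powr (1 / p) \<le> qnorm (lr_of_ls p q) (embed_sum f)"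
      "(?b powr p) powr (1 / p) \<le> qnorm (lr_of_ls p q) (embed_sum f)"
      unfolding J using p by (intro powr_mono2; simp)+
    ultimately show "qnorm (lp_plus_lq p q) f \<le> 2 * qnorm (lr_of_ls p q) (embed_sum f)"
      unfolding eq by linarith
    have "?a powr p \<le> (?a + ?b) powr p" "?b powr p \<le> (?a + ?b) powr p"
      using p ab by (intro powr_mono2; simp)+
    then have "qnorm (lr_of_ls p q) (embed_sum f) \<le> (2 * (?a + ?b) powr p) powr (1 / p)"
      unfolding J using p by (intro powr_mono2) auto
    also have "\<dots> = 2 powr (1 / p) * qnorm (lp_plus_lq p q) f"
      unfolding eq using p ab by (simp add: powr_mult powr_powr)
    finally show "qnorm (lr_of_ls p q) (embed_sum f) \<le> 2 powr (1 / p) * qnorm (lp_plus_lq p q) f" .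
  qed simp_all
qed

theorem mainTheorem4:
  fixes p q :: real
  assumes "0 < p" and "p < 1" and "1 < q"
  shows
    "(\<forall>y :: nat \<Rightarrow> (nat \<Rightarrow> 'k::{real_normed_field,euclidean_space}) \<times> (nat \<Rightarrow> 'k).
        almost_greedy_basis (lp_plus_lq p q) y \<longrightarrow>
        equivalent_up_to_const (fundamental_function (lp_plus_lq p q) y) (\<lambda>m. real m powr (1 / q))) \<and>
     (\<forall>y :: nat \<Rightarrow> nat \<Rightarrow> nat \<Rightarrow> 'k.
        almost_greedy_basis (lr_of_ls p q) y \<longrightarrow>
        equivalent_up_to_const (fundamental_function (lr_of_ls p q) y) (\<lambda>m. real m powr (1 / q))) \<and>
     (\<forall>y :: nat \<Rightarrow> nat \<Rightarrow> nat \<Rightarrow> 'k.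
        almost_greedy_basis (lr_of_ls q p) y \<longrightarrow>
        equivalent_up_to_const (fundamental_function (lr_of_ls q p) y) (\<lambda>m. real m powr (1 / q))) \<and>
     (\<forall>y :: nat \<Rightarrow> nat \<Rightarrow> nat \<Rightarrow> 'k.
        almost_greedy_basis (lq_sum_lp_dims q p) y \<longrightarrow>
        equivalent_up_to_const (fundamental_function (lq_sum_lp_dims q p) y) (\<lambda>m. real m powr (1 / q)))"
proof (intro conjI allI impI)
  have q: "0 < q" using assms by simp
  note main = almost_greedy_basis_fundamental_function[OF _ _ assms]
  show "equivalent_up_to_const (fundamental_function (lp_plus_lq p q) y) (\<lambda>m. real m powr (1 / q))"
    if "almost_greedy_basis (lp_plus_lq p q) y" for y :: "nat \<Rightarrow> (nat \<Rightarrow> 'k) \<times> (nat \<Rightarrow> 'k)"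
    using quasi_normed_lp_plus_lq[OF assms(1) q] lq_units_lp_plus_lq[OF assms(1) q]
      difference_dichotomy_lp_plus_lq[OF assms] that main by blast
  show "equivalent_up_to_const (fundamental_function (lr_of_ls p q) y) (\<lambda>m. real m powr (1 / q))"
    if "almost_greedy_basis (lr_of_ls p q) y" for y :: "nat \<Rightarrow> nat \<Rightarrow> nat \<Rightarrow> 'k"
    using quasi_normed_lr_of_ls[OF assms(1) q] lq_units_lr_of_ls_inner[OF assms(1) q]
      difference_dichotomy_lp_of_lq[OF assms] that main by blast
  show "equivalent_up_to_const (fundamental_function (lr_of_ls q p) y) (\<lambda>m. real m powr (1 / q))"
    if "almost_greedy_basis (lr_of_ls q p) y" for y :: "nat \<Rightarrow> nat \<Rightarrow> nat \<Rightarrow> 'k"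
    using quasi_normed_lr_of_ls[OF q assms(1)] lq_units_lr_of_ls[OF assms(1) q]
      difference_dichotomy_lq_of_lp[OF assms] that main by blast
  show "equivalent_up_to_const (fundamental_function (lq_sum_lp_dims q p) y) (\<lambda>m. real m powr (1 / q))"
    if "almost_greedy_basis (lq_sum_lp_dims q p) y" for y :: "nat \<Rightarrow> nat \<Rightarrow> nat \<Rightarrow> 'k"
    using quasi_normed_lq_sum_lp_dims[OF assms(1) q] lq_units_lq_sum_lp_dims[OF assms(1) q]
      difference_dichotomy_lq_sum_lp_dims[OF assms] that main by blast
qed

end
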